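(* Assume that for every nonempty $S\subseteq[n]$ the linear model $f(Y)=X_S^T\beta_S+\varepsilon_S$ holds, that $\Lambda_S=\mathbb E[X_SX_S^T]$ is invertible and $\sigma_S^2>0$, and that there is a constant $1\le K<\infty$ such that for all nonempty $S\subseteq[n]$ $$\max\Big\{\sup_{\|\theta\|_2=1}\mathbb E[\langle X_S,\theta\rangle^4]^{1/4},\ \big\|\,\|X_S\|_2\,\big\|_{\psi_1}\Big\}\le K .$$ Let $(\alpha_t)$ be a nonincreasing sequence of positive regularization parameters with $\lim_{t\to\infty}\alpha_t=0$. Assume that $S\mapsto\big(\sqrt{k_1(S)}+\sqrt{c_{\mathrm{epr}}k_2(S)}\big)^2$ has a unique minimizer $S^*$ over the nonempty subsets of $[n]$, and let $m_{S^*}=m_{S^*}(B)=\dfrac{B}{c_{\mathrm{epr}}+\sqrt{c_{\mathrm{epr}}k_1(S^* )/k_2(S^* )}}$. Let $m(B)$ be the number of exploration rounds chosen by the AETC algorithm (described in the context) under budget $B$, and $S(B)=S^*(m(B))$ the model it selects for exploitation. Then, with probability $1$, $$\lim_{B\to\infty}\frac{m(B)}{m_{S^*}(B)}=1\qquad\text{and}\qquad \lim_{B\to\infty}S(B)=S^*$$ (the latter meaning $S(B)=S^*$ for all sufficiently large $B$).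
   Context: Setting. $n\in\mathbb N$; $X^{(1)},\dots,X^{(n)}$ (low-fidelity outputs) and $f(Y)$ (high-fidelity output) are real random variables on a common probability space, with sampling costs $c_1,\dots,c_n>0$ and $c_0>0$. For nonempty $S\subseteq[n]=\{1,\dots,n\}$ with $|S|=s$, $X_S=(1,(X^{(i)})_{i\in S})^T\in\mathbb R^{s+1}$. The linear model assumption for $S$ is $f(Y)=X_S^T\beta_S+\varepsilon_S$ with $\beta_S\in\mathbb R^{s+1}$ deterministic and $\varepsilon_S$ a centered sub-Gaussian random variable with variance $\sigma_S^2$, independent of $X_S$. Write $x_S=\mathbb E[X_S]$, $\Sigma_S=\mathrm{Cov}[X_S]$, $\Lambda_S=\mathbb E[X_SX_S^T]$. Costs: $c_{\mathrm{epr}}=\sum_{i=0}^n c_i$, $c_{\mathrm{ept}}(S)=\sum_{i\in S}c_i$. For a random variable $W$ and $\alpha\ge1$, $\|W\|_{\psi_\alpha}=\inf\{C>0:\mathbb E[\exp(|W|^\alpha/C^\alpha)]\le2\}$. Oracle quantities: $k_1(S)=c_{\mathrm{ept}}(S)\,\beta_S^T\Sigma_S\beta_S$ and $k_2(S)=\sigma_S^2\,\mathrm{tr}(x_Sx_S^T\Lambda_S^{-1})$. Data. There is a single infinite i.i.d. sequence of joint exploration samples $(X^{(1)}_\ell,\dots,X^{(n)}_\ell,f(Y_\ell))$, $\ell=1,2,\dots$, used for all budgets $B$. Let $X_{\ell}|_S=(1,(X_\ell^{(i)})_{i\in S})^T$. For $t\ge n+2$ let $Z_S=Z_S(t)$ be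 the $t\times(s+1)$ matrix with rows $X_\ell|_S^T$, $\ell\le t$; it is assumed throughout that $Z_S(t)$ has full column rank. Define - $\widehat\beta_S(t)=(Z_S^TZ_S)^{-1}Z_S^T(f(Y_1),\dots,f(Y_t))^T$, - $\widehat x_S(t)=\frac1t\sum_{\ell\le t}X_\ell|_S$, - $\widehat\Sigma_S(t)=\frac1{t-1}\sum_{\ell\le t}(X_\ell|_S-\widehat x_S(t))(X_\ell|_S-\widehat x_S(t))^T$, - $\widehat\sigma_S^2(t)=\frac1{t-s-1}\sum_{\ell\le t}(f(Y_\ell)-X_\ell|_S^T\widehat\beta_S(t))^2$, - $\widehat\Lambda_S^{-1}(t)=(\frac1tZ_S^TZ_S)^{-1}$, - $k_{1,t}(S)=c_{\mathrm{ept}}(S)\widehat\beta_S(t)^T\widehat\Sigma_S(t)\widehat\beta_S(t)$, - $k_{2,t}(S)=\widehat\sigma_S^2(t)\,\mathrm{tr}(\widehat x_S(t)\widehat x_S(t)^T\widehat\Lambda_S^{-1}(t))+\alpha_t$ (regularized), - $m_S(t)=\dfrac{B}{c_{\mathrm{epr}}+\sqrt{c_{\mathrm{epr}}k_{1,t}(S)/k_{2,t}(S)}}$. AETC algorithm with budget $B$. Put $M=\lfloor B/c_{\mathrm{epr}}\rfloor$. First collect $n+2$ exploration samples. Then for $t=n+2,n+3,\dots$ with $t\le M$: for every nonempty $S\subseteq[n]$ compute $$h_S(t)=\frac{k_{1,t}(S)}{B-c_{\mathrm{epr}}\,m}+\frac{k_{2,t}(S)}{m}\quad\text{at } m=\max\{m_S(t),t\};$$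 let $S^*(t)=\operatorname{argmin}_S h_S(t)$ (ties broken by any fixed rule). If $m_{S^*(t)}(t)>t$, collect one more exploration sample and increase $t$ by $1$; otherwise stop exploring and commit to model $S^*(t)$ for exploitation. $m(B)$ is the value of $t$ at which exploration stops, i.e. the smallest $t\in\{n+2,\dots,M\}$ with $m_{S^*(t)}(t)\le t$ (by convention $m(B)=M$ if there is no such $t$). Integer rounding effects are ignored in the definition of $m_S$ and $m_{S^*}$.
   Formalization: When c_epr·t = B exactly, h_S(t) has a zero denominator and is undefined; there models are compared lexicographically by (k_{1,t}(S), k_{2,t}(S)), the limit of vanishing remaining budget. This affects the result only if k_1(S* ) = 0. *)

theory Defs
  imports
    "HOL-Probability.Probability"
    "Jordan_Normal_Form.Gauss_Jordan_Elimination"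
    "Jordan_Normal_Form.DL_Rank"
begin

text \<open>
  The dimension of the regression vectors varies with the model, so vectors and matrices are
  those of \<^typ>\<open>real Matrix.vec\<close> and \<^typ>\<open>real Matrix.mat\<close>, with 0-based indices.
\<close>

unbundle no vec_syntax
unbundle no inner_syntax
hide_const (open) Finite_Cartesian_Product.vec Finite_Cartesian_Product.mat
hide_type (open) Finite_Cartesian_Product.vec

definition inv_mat :: "real mat \<Rightarrow> real mat" where
  "inv_mat A = the (mat_inverse A)"

definition mat_trace :: "real mat \<Rightarrow> real" where
  "mat_trace A = (\<Sum>i<dim_row A. A $$ (i, i))"

definition outer :: "real vec \<Rightarrow> real vec \<Rightarrow> real mat" where
  "outer v w = mat (dim_vec v) (dim_vec w) (\<lambda>(i, j). v $ i * w $ j)"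

definition vnorm :: "real vec \<Rightarrow> real" where
  "vnorm v = sqrt (v \<bullet> v)"

text \<open>The infimum over the empty set is \<^term>\<open>\<infinity>::ennreal\<close>, so finiteness of the norm is a genuine condition.\<close>

definition psi_norm :: "'p measure \<Rightarrow> real \<Rightarrow> ('p \<Rightarrow> real) \<Rightarrow> ennreal" where
  "psi_norm P a W =
     (INF C\<in>{C::real. C > 0 \<and> (\<integral>\<^sup>+\<omega>. ennreal (exp (\<bar>W \<omega>\<bar> powr a / C powr a)) \<partial>P) \<le> 2}. ennreal C)"

definition models :: "nat \<Rightarrow> nat set set" where
  "models n = {S. S \<noteq> {} \<and> S \<subseteq> {1..n}}"

text \<open>The vector \<open>(1, (x\<^sub>i)\<^sub>i\<^sub>\<in>\<^sub>S)\<close> with the indices in \<open>S\<close> in increasing order.\<close>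

definition feat :: "nat set \<Rightarrow> (nat \<Rightarrow> real) \<Rightarrow> real vec" where
  "feat S x = vec_of_list (1 # map x (sorted_list_of_set S))"

definition c_epr :: "nat \<Rightarrow> (nat \<Rightarrow> real) \<Rightarrow> real" where
  "c_epr n c = (\<Sum>i=0..n. c i)"

definition c_ept :: "(nat \<Rightarrow> real) \<Rightarrow> nat set \<Rightarrow> real" where
  "c_ept c S = (\<Sum>i\<in>S. c i)"


section \<open>Population quantities\<close>

text \<open>\<open>X i\<close> is the \<open>i\<close>-th low-fidelity output (\<open>1 \<le> i \<le> n\<close>), \<open>Y\<close> the high-fidelity output \<open>f(Y)\<close>.\<close>

definition XS :: "(nat \<Rightarrow> 'p \<Rightarrow> real) \<Rightarrow> nat set \<Rightarrow> 'p \<Rightarrow> real vec" where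
  "XS X S \<omega> = feat S (\<lambda>i. X i \<omega>)"

definition mean_vec :: "'p measure \<Rightarrow> (nat \<Rightarrow> 'p \<Rightarrow> real) \<Rightarrow> nat set \<Rightarrow> real vec" where
  "mean_vec P X S = vec (card S + 1) (\<lambda>i. \<integral>\<omega>. XS X S \<omega> $ i \<partial>P)"

definition cov_mat :: "'p measure \<Rightarrow> (nat \<Rightarrow> 'p \<Rightarrow> real) \<Rightarrow> nat set \<Rightarrow> real mat" where
  "cov_mat P X S = mat (card S + 1) (card S + 1)
     (\<lambda>(i, j). \<integral>\<omega>. (XS X S \<omega> $ i - mean_vec P X S $ i) * (XS X S \<omega> $ j - mean_vec P X S $ j) \<partial>P)"

definition moment_mat :: "'p measure \<Rightarrow> (nat \<Rightarrow> 'p \<Rightarrow> real) \<Rightarrow> nat set \<Rightarrow> real mat" where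
  "moment_mat P X S = mat (card S + 1) (card S + 1)
     (\<lambda>(i, j). \<integral>\<omega>. XS X S \<omega> $ i * XS X S \<omega> $ j \<partial>P)"

text \<open>
  Independence of the noise from \<open>X\<^sub>S\<close> is independence of the generated sigma-algebras; the
  constant coordinate of \<open>X\<^sub>S\<close> is dropped. (The library's independence of two variables needs
  them to have the same type.)
\<close>

definition linear_model ::
  "'p measure \<Rightarrow> (nat \<Rightarrow> 'p \<Rightarrow> real) \<Rightarrow> ('p \<Rightarrow> real) \<Rightarrow> nat set \<Rightarrow> real vec \<Rightarrow> real \<Rightarrow> bool" where
  "linear_model P X Y S b v \<longleftrightarrow>
     b \<in> carrier_vec (card S + 1) \<and>
     (\<exists>e. e \<in> borel_measurable P \<and>
          (AE \<omega> in P. Y \<omega> = XS X S \<omega> \<bullet> b + e \<omega>) \<and>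
          psi_norm P 2 e < \<infinity> \<and>
          prob_space.expectation P e = 0 \<and>
          prob_space.variance P e = v \<and>
          prob_space.indep_set P
            (sets (vimage_algebra (space P) e borel))
            (sets (vimage_algebra (space P) (\<lambda>\<omega>. \<lambda>i\<in>S. X i \<omega>) (PiM S (\<lambda>_. borel)))))"

definition moment_bound :: "'p measure \<Rightarrow> (nat \<Rightarrow> 'p \<Rightarrow> real) \<Rightarrow> nat set \<Rightarrow> real \<Rightarrow> bool" where
  "moment_bound P X S K \<longleftrightarrow>
     (\<forall>\<theta>\<in>carrier_vec (card S + 1). vnorm \<theta> = 1 \<longrightarrow>
        integrable P (\<lambda>\<omega>. (XS X S \<omega> \<bullet> \<theta>) ^ 4) \<and>
        root 4 (\<integral>\<omega>. (XS X S \<omega> \<bullet> \<theta>) ^ 4 \<partial>P) \<le> K) \<and>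
     psi_norm P 1 (\<lambda>\<omega>. vnorm (XS X S \<omega>)) \<le> ennreal K"

definition k1 ::
  "'p measure \<Rightarrow> (nat \<Rightarrow> 'p \<Rightarrow> real) \<Rightarrow> (nat \<Rightarrow> real) \<Rightarrow> (nat set \<Rightarrow> real vec) \<Rightarrow> nat set \<Rightarrow> real" where
  "k1 P X c \<beta> S = c_ept c S * (\<beta> S \<bullet> (cov_mat P X S *\<^sub>v \<beta> S))"

definition k2 ::
  "'p measure \<Rightarrow> (nat \<Rightarrow> 'p \<Rightarrow> real) \<Rightarrow> (nat set \<Rightarrow> real) \<Rightarrow> nat set \<Rightarrow> real" where
  "k2 P X \<sigma>2 S =
     \<sigma>2 S * mat_trace (outer (mean_vec P X S) (mean_vec P X S) * inv_mat (moment_mat P X S))"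

definition opt_rounds :: "real \<Rightarrow> real \<Rightarrow> real \<Rightarrow> real \<Rightarrow> real" where
  "opt_rounds ce B \<kappa>1 \<kappa>2 = B / (ce + sqrt (ce * \<kappa>1 / \<kappa>2))"


section \<open>Samples and estimators\<close>

text \<open>Joint samples are \<open>(X\<^sub>\<ell>, Y\<^sub>\<ell>)\<close>, \<open>\<ell> = 1, 2, \<dots>\<close>; they may live on another probability space than \<open>(X, Y)\<close>.\<close>

definition joint :: "nat \<Rightarrow> (nat \<Rightarrow> 'p \<Rightarrow> real) \<Rightarrow> ('p \<Rightarrow> real) \<Rightarrow> 'p \<Rightarrow> (nat \<Rightarrow> real) \<times> real" where
  "joint n X Y \<omega> = (\<lambda>i\<in>{1..n}. X i \<omega>, Y \<omega>)"

definition joint_space :: "nat \<Rightarrow> ((nat \<Rightarrow> real) \<times> real) measure" where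
  "joint_space n = PiM {1..n} (\<lambda>_. borel) \<Otimes>\<^sub>M borel"

definition iid_samples ::
  "nat \<Rightarrow> 'p measure \<Rightarrow> (nat \<Rightarrow> 'p \<Rightarrow> real) \<Rightarrow> ('p \<Rightarrow> real) \<Rightarrow>
   'w measure \<Rightarrow> (nat \<Rightarrow> nat \<Rightarrow> 'w \<Rightarrow> real) \<Rightarrow> (nat \<Rightarrow> 'w \<Rightarrow> real) \<Rightarrow> bool" where
  "iid_samples n P X Y M Xs Ys \<longleftrightarrow>
     prob_space.indep_vars M (\<lambda>_. joint_space n) (\<lambda>l. joint n (Xs l) (Ys l)) {1..} \<and>
     (\<forall>l\<ge>1. distr M (joint_space n) (joint n (Xs l) (Ys l)) = distr P (joint_space n) (joint n X Y))"

text \<open>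
  The estimators are functions of a realised data path: \<open>x l i\<close> is the \<open>l\<close>-th sample of the
  \<open>i\<close>-th low-fidelity output and \<open>y l\<close> the \<open>l\<close>-th sample of the high-fidelity output.
\<close>

definition design :: "(nat \<Rightarrow> nat \<Rightarrow> real) \<Rightarrow> nat \<Rightarrow> nat set \<Rightarrow> real mat" where
  "design x t S = mat_of_rows (card S + 1) (map (\<lambda>l. feat S (x l)) [1..<t + 1])"

definition beta_hat ::
  "(nat \<Rightarrow> nat \<Rightarrow> real) \<Rightarrow> (nat \<Rightarrow> real) \<Rightarrow> nat \<Rightarrow> nat set \<Rightarrow> real vec" where
  "beta_hat x y t S =
     (inv_mat (transpose_mat (design x t S) * design x t S) * transpose_mat (design x t S))
       *\<^sub>v vec_of_list (map y [1..<t + 1])"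

definition mean_hat :: "(nat \<Rightarrow> nat \<Rightarrow> real) \<Rightarrow> nat \<Rightarrow> nat set \<Rightarrow> real vec" where
  "mean_hat x t S = vec (card S + 1) (\<lambda>i. 1 / real t * (\<Sum>l=1..t. feat S (x l) $ i))"

definition cov_hat :: "(nat \<Rightarrow> nat \<Rightarrow> real) \<Rightarrow> nat \<Rightarrow> nat set \<Rightarrow> real mat" where
  "cov_hat x t S = mat (card S + 1) (card S + 1)
     (\<lambda>(i, j). 1 / (real t - 1) *
        (\<Sum>l=1..t. (feat S (x l) $ i - mean_hat x t S $ i) * (feat S (x l) $ j - mean_hat x t S $ j)))"

definition var_hat ::
  "(nat \<Rightarrow> nat \<Rightarrow> real) \<Rightarrow> (nat \<Rightarrow> real) \<Rightarrow> nat \<Rightarrow> nat set \<Rightarrow> real" where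
  "var_hat x y t S =
     1 / (real t - real (card S) - 1) * (\<Sum>l=1..t. (y l - feat S (x l) \<bullet> beta_hat x y t S)\<^sup>2)"

definition moment_inv_hat :: "(nat \<Rightarrow> nat \<Rightarrow> real) \<Rightarrow> nat \<Rightarrow> nat set \<Rightarrow> real mat" where
  "moment_inv_hat x t S =
     inv_mat ((1 / real t) \<cdot>\<^sub>m (transpose_mat (design x t S) * design x t S))"

definition k1_hat ::
  "(nat \<Rightarrow> real) \<Rightarrow> (nat \<Rightarrow> nat \<Rightarrow> real) \<Rightarrow> (nat \<Rightarrow> real) \<Rightarrow> nat \<Rightarrow> nat set \<Rightarrow> real" where
  "k1_hat c x y t S =
     c_ept c S * (beta_hat x y t S \<bullet> (cov_hat x t S *\<^sub>v beta_hat x y t S))"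

definition k2_hat ::
  "(nat \<Rightarrow> real) \<Rightarrow> (nat \<Rightarrow> nat \<Rightarrow> real) \<Rightarrow> (nat \<Rightarrow> real) \<Rightarrow> nat \<Rightarrow> nat set \<Rightarrow> real" where
  "k2_hat \<alpha> x y t S =
     var_hat x y t S * mat_trace (outer (mean_hat x t S) (mean_hat x t S) * moment_inv_hat x t S) + \<alpha> t"


section \<open>The AETC algorithm\<close>

definition m_hat ::
  "nat \<Rightarrow> (nat \<Rightarrow> real) \<Rightarrow> (nat \<Rightarrow> real) \<Rightarrow> (nat \<Rightarrow> nat \<Rightarrow> real) \<Rightarrow> (nat \<Rightarrow> real) \<Rightarrow>
   real \<Rightarrow> nat \<Rightarrow> nat set \<Rightarrow> real" where
  "m_hat n c \<alpha> x y B t S = opt_rounds (c_epr n c) B (k1_hat c x y t S) (k2_hat \<alpha> x y t S)"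

definition h_hat ::
  "nat \<Rightarrow> (nat \<Rightarrow> real) \<Rightarrow> (nat \<Rightarrow> real) \<Rightarrow> (nat \<Rightarrow> nat \<Rightarrow> real) \<Rightarrow> (nat \<Rightarrow> real) \<Rightarrow>
   real \<Rightarrow> nat \<Rightarrow> nat set \<Rightarrow> real" where
  "h_hat n c \<alpha> x y B t S =
     (let m = max (m_hat n c \<alpha> x y B t S) (real t)
      in k1_hat c x y t S / (B - c_epr n c * m) + k2_hat \<alpha> x y t S / m)"

text \<open>
  \<open>S\<close> is at least as good as \<open>S'\<close> at time \<open>t\<close>. If \<open>c\<^sub>e\<^sub>p\<^sub>r t < B\<close> this is \<open>h\<^sub>S(t) \<le> h\<^sub>S\<^sub>'(t)\<close>; there
  \<open>B - c\<^sub>e\<^sub>p\<^sub>r m\<close> vanishes only if \<open>k\<^sub>1\<^sub>,\<^sub>t(S) = 0\<close>, and then \<open>0 / 0 = 0\<close> gives the minimum of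
  \<open>k\<^sub>2\<^sub>,\<^sub>t(S) / m\<close> over \<open>m\<close>, as it should. If \<open>c\<^sub>e\<^sub>p\<^sub>r t = B\<close>, then \<open>m = t\<close> and \<open>h\<^sub>S(t) = k\<^sub>1\<^sub>,\<^sub>t(S) / 0 + k\<^sub>2\<^sub>,\<^sub>t(S) / t\<close>
  is undefined for every \<open>S\<close>. The comparison is then the one between \<open>k\<^sub>1\<^sub>,\<^sub>t(S) / r + k\<^sub>2\<^sub>,\<^sub>t(S) / t\<close> and
  \<open>k\<^sub>1\<^sub>,\<^sub>t(S') / r + k\<^sub>2\<^sub>,\<^sub>t(S') / t\<close> for all sufficiently small \<open>r > 0\<close>, which is lexicographic.
\<close>

definition model_le ::
  "nat \<Rightarrow> (nat \<Rightarrow> real) \<Rightarrow> (nat \<Rightarrow> real) \<Rightarrow> (nat \<Rightarrow> nat \<Rightarrow> real) \<Rightarrow> (nat \<Rightarrow> real) \<Rightarrow>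
   real \<Rightarrow> nat \<Rightarrow> nat set \<Rightarrow> nat set \<Rightarrow> bool" where
  "model_le n c \<alpha> x y B t S S' \<longleftrightarrow>
     (if c_epr n c * real t < B then h_hat n c \<alpha> x y B t S \<le> h_hat n c \<alpha> x y B t S'
      else k1_hat c x y t S < k1_hat c x y t S' \<or>
           k1_hat c x y t S = k1_hat c x y t S' \<and> k2_hat \<alpha> x y t S \<le> k2_hat \<alpha> x y t S')"

text \<open>\<open>tie\<close> picks an element of the set of minimisers.\<close>

definition S_hat ::
  "nat \<Rightarrow> (nat \<Rightarrow> real) \<Rightarrow> (nat \<Rightarrow> real) \<Rightarrow> (nat set set \<Rightarrow> nat set) \<Rightarrow>
   (nat \<Rightarrow> nat \<Rightarrow> real) \<Rightarrow> (nat \<Rightarrow> real) \<Rightarrow> real \<Rightarrow> nat \<Rightarrow> nat set" where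
  "S_hat n c \<alpha> tie x y B t =
     tie {S \<in> models n. \<forall>S'\<in>models n. model_le n c \<alpha> x y B t S S'}"

definition max_rounds :: "nat \<Rightarrow> (nat \<Rightarrow> real) \<Rightarrow> real \<Rightarrow> nat" where
  "max_rounds n c B = nat \<lfloor>B / c_epr n c\<rfloor>"

definition stops ::
  "nat \<Rightarrow> (nat \<Rightarrow> real) \<Rightarrow> (nat \<Rightarrow> real) \<Rightarrow> (nat set set \<Rightarrow> nat set) \<Rightarrow>
   (nat \<Rightarrow> nat \<Rightarrow> real) \<Rightarrow> (nat \<Rightarrow> real) \<Rightarrow> real \<Rightarrow> nat \<Rightarrow> bool" where
  "stops n c \<alpha> tie x y B t \<longleftrightarrow>
     t \<in> {n + 2..max_rounds n c B} \<and>
     m_hat n c \<alpha> x y B t (S_hat n c \<alpha> tie x y B t) \<le> real t"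

definition aetc_rounds ::
  "nat \<Rightarrow> (nat \<Rightarrow> real) \<Rightarrow> (nat \<Rightarrow> real) \<Rightarrow> (nat set set \<Rightarrow> nat set) \<Rightarrow>
   (nat \<Rightarrow> nat \<Rightarrow> real) \<Rightarrow> (nat \<Rightarrow> real) \<Rightarrow> real \<Rightarrow> nat" where
  "aetc_rounds n c \<alpha> tie x y B =
     (if \<exists>t. stops n c \<alpha> tie x y B t then LEAST t. stops n c \<alpha> tie x y B t
      else max_rounds n c B)"

definition aetc_model ::
  "nat \<Rightarrow> (nat \<Rightarrow> real) \<Rightarrow> (nat \<Rightarrow> real) \<Rightarrow> (nat set set \<Rightarrow> nat set) \<Rightarrow>
   (nat \<Rightarrow> nat \<Rightarrow> real) \<Rightarrow> (nat \<Rightarrow> real) \<Rightarrow> real \<Rightarrow> nat set" where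
  "aetc_model n c \<alpha> tie x y B = S_hat n c \<alpha> tie x y B (aetc_rounds n c \<alpha> tie x y B)"

end

theory Submission
  imports Defs
begin

text \<open>
  The Orlicz bounds give all moments of \<open>X\<^sub>S\<close>, of the noise and of \<open>f(Y)\<close>, so a fourth-moment strong law
  makes all sample second moments converge almost surely; by continuity of the matrix inverse the
  estimators \<open>k\<^sub>1\<^sub>,\<^sub>t(S)\<close> and \<open>k\<^sub>2\<^sub>,\<^sub>t(S)\<close> converge to \<open>k\<^sub>1(S)\<close> and \<open>k\<^sub>2(S)\<close>. The rest is deterministic. Up to the
  scaling \<open>u = t / B\<close>, a model whose optimal time \<open>m\<^sub>S(t)\<close> is not yet reached has the objective
  \<open>(sqrt k\<^sub>1 + sqrt (c\<^sub>e\<^sub>p\<^sub>r k\<^sub>2))\<^sup>2 / B\<close>, and no model is ever below this value. Hence \<open>S\<^sup>*\<close> is selected at all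
  large times up to slightly beyond \<open>m\<^sub>S\<^sub>*\<close>, which forces exploration to stop close to \<open>m\<^sub>S\<^sub>*\<close>. For fixed
  small \<open>t\<close> nothing stops once \<open>B\<close> is large.

  The delicate case is \<open>k\<^sub>1(S\<^sup>*) = 0\<close>, where \<open>m\<^sub>S\<^sub>* = B / c\<^sub>e\<^sub>p\<^sub>r\<close> exhausts the budget. There
  \<open>Var f(Y) = \<beta>\<^sub>S\<^sup>T \<Sigma>\<^sub>S \<beta>\<^sub>S + \<sigma>\<^sub>S\<^sup>2\<close> and uniqueness of \<open>S\<^sup>*\<close> imply \<open>k\<^sub>1(S) > 0\<close> for all other \<open>S\<close>, so near the end
  of the budget their exploitation term dominates.
\<close>

section \<open>Inverses and Gram matrices\<close>

text \<open>A nonzero determinant makes \<open>A\<close> a unit of the matrix ring, which excludes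
  the value \<open>None\<close> of \<open>mat_inverse\<close>; so \<open>the\<close> in
  \<open>inv_mat\<close> returns the genuine inverse.\<close>

lemma inv_mat_nonsingular:
  assumes A: "A \<in> carrier_mat d d" and "det A \<noteq> 0"
  shows "inv_mat A \<in> carrier_mat d d" "A * inv_mat A = 1\<^sub>m d" "inv_mat A * A = 1\<^sub>m d"
proof -
  have "A \<in> Units (ring_mat TYPE(real) d ())" by (rule det_non_zero_imp_unit[OF assms])
  then obtain B where B: "mat_inverse A = Some B"
    using mat_inverse(1)[OF A, where b = "()"] by (cases "mat_inverse A") auto
  from mat_inverse(2)[OF A B] show "inv_mat A \<in> carrier_mat d d" "A * inv_mat A = 1\<^sub>m d" "inv_mat A * A = 1\<^sub>m d"
    by (auto simp: inv_mat_def B)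
qed

lemma det_nonzero_if_right_inverse:
  assumes A: "A \<in> carrier_mat d d" and B: "B \<in> carrier_mat d d" and AB: "A * B = (1\<^sub>m d :: real mat)"
  shows "det A \<noteq> 0"
  using det_mult[OF A B] AB by auto

lemma inv_mat_unique:
  assumes A: "A \<in> carrier_mat d d" and B: "B \<in> carrier_mat d d" and AB: "A * B = 1\<^sub>m d"
  shows "inv_mat A = B"
proof -
  note inv = inv_mat_nonsingular[OF A det_nonzero_if_right_inverse[OF assms]]
  have "inv_mat A = inv_mat A * (A * B)" using inv by (simp add: AB)
  also have "\<dots> = B" using inv A B by (simp add: assoc_mult_mat[symmetric, of _ d d _ d _ d])
  finally show ?thesis .
qed

lemma invertible_mat_det_nonzero:
  assumes A: "(A :: real mat) \<in> carrier_mat d d" and "invertible_mat A"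
  shows "det A \<noteq> 0"
proof -
  obtain B where AB: "A * B = 1\<^sub>m (dim_row A)" and BA: "B * A = 1\<^sub>m (dim_row B)"
    using assms(2) by (auto simp: invertible_mat_def inverts_mat_def)
  \<comment> \<open>\<open>invertible_mat\<close> leaves the shape of \<open>B\<close> open;
    comparing column counts in the two products fixes it.\<close>
  have "dim_col B = d" using arg_cong[OF AB, of dim_col] A by simp
  moreover have "dim_row B = d" using arg_cong[OF BA, of dim_col] A by simp
  ultimately have "B \<in> carrier_mat d d" by auto
  then show ?thesis using det_nonzero_if_right_inverse[OF A] AB A by simp
qed

lemma smult_smult_mat: "k \<cdot>\<^sub>m (l \<cdot>\<^sub>m A) = (k * l :: real) \<cdot>\<^sub>m A"
  by (rule eq_matI) auto

lemma one_smult_mat: "(1 :: real) \<cdot>\<^sub>m A = A"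
  by (rule eq_matI) auto

lemma inv_mat_smult:
  assumes A: "A \<in> carrier_mat d d" and "det A \<noteq> 0" "k \<noteq> 0"
  shows "inv_mat (k \<cdot>\<^sub>m A) = (1 / k) \<cdot>\<^sub>m inv_mat A"
proof (rule inv_mat_unique)
  note inv = inv_mat_nonsingular[OF assms(1,2)]
  show "k \<cdot>\<^sub>m A * ((1 / k) \<cdot>\<^sub>m inv_mat A) = 1\<^sub>m d"
    using inv A \<open>k \<noteq> 0\<close> by (simp add: mult_smult_assoc_mat[of _ d d _ d] mult_smult_distrib[of _ d d _ d] smult_smult_mat one_smult_mat)
qed (use assms inv_mat_nonsingular in auto)

text \<open>Used for continuity: Cramer's formula writes every entry of the inverse as a polynomial
  in the entries of \<open>A\<close> divided by \<open>det A\<close>, which the elimination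
  procedure behind \<open>mat_inverse\<close> does not show.\<close>

lemma inv_mat_eq_adj_mat:
  assumes A: "A \<in> carrier_mat d d" and "det A \<noteq> 0"
  shows "inv_mat A = (1 / det A) \<cdot>\<^sub>m adj_mat A"
proof (rule inv_mat_unique[OF A])
  show "A * ((1 / det A) \<cdot>\<^sub>m adj_mat A) = 1\<^sub>m d"
    using adj_mat[OF A] A \<open>det A \<noteq> 0\<close> by (simp add: mult_smult_distrib[of _ d d _ d] smult_smult_mat one_smult_mat)
qed (use adj_mat[OF A] in auto)

section \<open>Continuity of determinant, adjugate and inverse\<close>

lemma tendsto_det:
  fixes A :: "'t \<Rightarrow> real mat"
  assumes "\<And>t. A t \<in> carrier_mat d d" "L \<in> carrier_mat d d"
    and "\<And>i j. i < d \<Longrightarrow> j < d \<Longrightarrow> ((\<lambda>t. A t $$ (i, j)) \<longlongrightarrow> L $$ (i, j)) F"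
  shows "((\<lambda>t. det (A t)) \<longlongrightarrow> det L) F"
  unfolding det_def'[OF assms(1)] det_def'[OF assms(2)]
  by (intro tendsto_sum tendsto_mult tendsto_const tendsto_prod assms(3))
     (auto dest: permutes_in_image)

lemma tendsto_adj_mat:
  fixes A :: "'t \<Rightarrow> real mat"
  assumes A: "\<And>t. A t \<in> carrier_mat d d" "L \<in> carrier_mat d d"
    and lim: "\<And>i j. i < d \<Longrightarrow> j < d \<Longrightarrow> ((\<lambda>t. A t $$ (i, j)) \<longlongrightarrow> L $$ (i, j)) F"
    and ij: "i < d" "j < d"
  shows "((\<lambda>t. adj_mat (A t) $$ (i, j)) \<longlongrightarrow> adj_mat L $$ (i, j)) F"
proof -
  have "((\<lambda>t. det (mat_delete (A t) j i)) \<longlongrightarrow> det (mat_delete L j i)) F"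
  proof (rule tendsto_det[where d = "d - 1"])
    fix k l assume "k < d - 1" "l < d - 1"
    then show "((\<lambda>t. mat_delete (A t) j i $$ (k, l)) \<longlongrightarrow> mat_delete L j i $$ (k, l)) F"
      using lim A by (auto simp: mat_delete_def carrier_matD[OF A(1)] carrier_matD[OF A(2)] intro!: lim)
  qed (use A mat_delete_carrier in \<open>blast+\<close>)
  then show ?thesis
    using ij by (simp add: adj_mat_def cofactor_def carrier_matD[OF A(1)] carrier_matD[OF A(2)] tendsto_mult_left)
qed

text \<open>Nonsingularity is assumed of the limit only. Since the determinants converge to
  \<open>det L\<close>, the matrices \<open>A t\<close> are eventually nonsingular as well, and the
  adjugate formula applies to them.\<close>

lemma tendsto_inv_mat:
  fixes A :: "'t \<Rightarrow> real mat"
  assumes A: "\<And>t. A t \<in> carrier_mat d d" "L \<in> carrier_mat d d" and "det L \<noteq> 0"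
    and lim: "\<And>i j. i < d \<Longrightarrow> j < d \<Longrightarrow> ((\<lambda>t. A t $$ (i, j)) \<longlongrightarrow> L $$ (i, j)) F"
    and ij: "i < d" "j < d"
  shows "((\<lambda>t. inv_mat (A t) $$ (i, j)) \<longlongrightarrow> inv_mat L $$ (i, j)) F"
proof -
  have det_lim: "((\<lambda>t. det (A t)) \<longlongrightarrow> det L) F" by (rule tendsto_det[OF A lim])
  have entry: "inv_mat B $$ (i, j) = 1 / det B * adj_mat B $$ (i, j)"
    if "B \<in> carrier_mat d d" "det B \<noteq> 0" for B
    using inv_mat_eq_adj_mat[OF that] adj_mat(1)[OF that(1)] ij by simp
  have "((\<lambda>t. 1 / det (A t) * adj_mat (A t) $$ (i, j)) \<longlongrightarrow> 1 / det L * adj_mat L $$ (i, j)) F"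
    using \<open>det L \<noteq> 0\<close> by (intro tendsto_intros det_lim tendsto_adj_mat[OF A lim]) (use ij in auto)
  moreover have "\<forall>\<^sub>F t in F. 1 / det (A t) * adj_mat (A t) $$ (i, j) = inv_mat (A t) $$ (i, j)"
    using tendsto_imp_eventually_ne[OF det_lim \<open>det L \<noteq> 0\<close>] by eventually_elim (simp add: entry A)
  ultimately show ?thesis unfolding entry[OF A(2) \<open>det L \<noteq> 0\<close>] by (rule Lim_transform_eventually)
qed

section \<open>Full column rank and nonsingular Gram matrices\<close>

lemma (in vec_space) full_column_rank_inj:
  assumes A: "A \<in> carrier_mat n nc" and rank: "rank A = nc"
    and v: "v \<in> carrier_vec nc" "A *\<^sub>v v = 0\<^sub>v n"
  shows "v = 0\<^sub>v nc"
proof -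
  \<comment> \<open>Linear independence concerns the set of columns, in which a repeated column
    would be lost. A repetition would leave fewer than \<open>nc\<close> columns in that set, and
    the rank is the size of a maximal independent subset of it.\<close>
  have "distinct (cols A)"
  proof (rule ccontr)
    assume "\<not> distinct (cols A)"
    then have less: "card (set (cols A)) < nc"
      using A card_distinct[of "cols A"] card_length[of "cols A"] by (auto simp: le_less)
    obtain S where S: "maximal S (\<lambda>T. T \<subseteq> set (cols A) \<and> lin_indpt T)"
      using maximal_exists_superset[of "set (cols A)" "\<lambda>T. T \<subseteq> set (cols A) \<and> lin_indpt T" "{}"]
        finite_lin_indpt2[of "{}"] by auto
    then have "card S \<le> card (set (cols A))" by (simp add: card_mono maximal_def)
    then show False using less rank rank_card_indpt[OF A S] by simp
  qed
  then show ?thesis using lin_depI[OF A v(1) _ v(2)] full_rank_lin_indpt[OF A rank] by blast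
qed

text \<open>A vector \<open>v\<close> in the kernel of the Gram matrix satisfies
  \<open>(Z *\<^sub>v v) \<bullet> (Z *\<^sub>v v) = 0\<close>, hence lies in the kernel of
  \<open>Z\<close>, which is trivial by full rank.\<close>

lemma det_gram_nonzero:
  fixes Z :: "real mat"
  assumes Z: "Z \<in> carrier_mat t d" and rank: "vec_space.rank t Z = d"
  shows "det (transpose_mat Z * Z) \<noteq> 0"
proof
  have G: "transpose_mat Z * Z \<in> carrier_mat d d" using Z by simp
  assume "det (transpose_mat Z * Z) = 0"
  then obtain v where v: "v \<in> carrier_vec d" "v \<noteq> 0\<^sub>v d" "(transpose_mat Z * Z) *\<^sub>v v = 0\<^sub>v d"
    using det_0_iff_vec_prod_zero_field[OF G] by auto
  have Zv: "Z *\<^sub>v v \<in> carrier_vec t" using Z v by simp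
  have "(Z *\<^sub>v v) \<bullet> (Z *\<^sub>v v) = v \<bullet> (transpose_mat Z *\<^sub>v (Z *\<^sub>v v))"
    using Z v Zv transpose_vec_mult_scalar[OF Z v(1) Zv] by (simp add: comm_scalar_prod[of _ d])
  also have "transpose_mat Z *\<^sub>v (Z *\<^sub>v v) = (transpose_mat Z * Z) *\<^sub>v v"
    using v Z by (intro assoc_mult_mat_vec[symmetric]) auto
  also have "v \<bullet> \<dots> = 0" using v by simp
  finally have "(\<Sum>i\<in>{0..<t}. ((Z *\<^sub>v v) $ i)\<^sup>2) = 0"
    using Z by (simp add: scalar_prod_def power2_eq_square)
  then have "Z *\<^sub>v v = 0\<^sub>v t"
    using Zv Z by (intro eq_vecI) (auto simp: sum_nonneg_eq_0_iff)
  then show False using vec_space.full_column_rank_inj[OF Z rank v(1)] v(2) by simp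
qed


lemma scalar_prod_mult_mat_vec:
  fixes v :: "real vec"
  assumes "v \<in> carrier_vec d" "C \<in> carrier_mat d d"
  shows "v \<bullet> (C *\<^sub>v v) = (\<Sum>i<d. \<Sum>j<d. v $ i * v $ j * C $$ (i, j))"
  using assms by (auto simp: scalar_prod_def sum_distrib_left lessThan_atLeast0 mult_ac intro!: sum.cong)

lemma index_mult_mat_vec_sum:
  fixes v :: "real vec"
  assumes "v \<in> carrier_vec d" "C \<in> carrier_mat k d" "i < k"
  shows "(C *\<^sub>v v) $ i = (\<Sum>j<d. C $$ (i, j) * v $ j)"
  using assms by (auto simp: scalar_prod_def lessThan_atLeast0 intro!: sum.cong)

text \<open>
  Since the first coordinate of \<open>X\<^sub>S\<close> is \<open>1\<close>, the mean is the first column of the moment matrix; this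
  makes the trace in the definitions of \<open>k\<^sub>2\<close> and \<open>k\<^sub>2\<^sub>,\<^sub>t\<close> equal to \<open>1\<close>.
\<close>

lemma trace_outer_inv_mat:
  assumes A: "A \<in> carrier_mat d d" and "det A \<noteq> 0" and v: "v \<in> carrier_vec d" "0 < d"
    and col: "\<And>i. i < d \<Longrightarrow> v $ i = A $$ (i, 0)" and "v $ 0 = 1"
  shows "mat_trace (outer v v * inv_mat A) = 1"
proof -
  note inv = inv_mat_nonsingular[OF assms(1,2)]
  \<comment> \<open>As \<open>v\<close> is column 0 of \<open>A\<close>, the inverse maps it to the
    first unit vector. The trace is the scalar product of \<open>v\<close> with this image, so it
    equals \<open>v $ 0\<close>.\<close>
  have unit: "(\<Sum>i<d. inv_mat A $$ (k, i) * v $ i) = (if k = 0 then 1 else 0)" if "k < d" for k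
  proof -
    have "(\<Sum>i<d. inv_mat A $$ (k, i) * v $ i) = (inv_mat A * A) $$ (k, 0)"
      using inv(1) A that v by (auto simp: scalar_prod_def lessThan_atLeast0 col intro!: sum.cong)
    then show ?thesis using inv(3) that v by simp
  qed
  have "mat_trace (outer v v * inv_mat A) = (\<Sum>i<d. \<Sum>k<d. v $ i * v $ k * inv_mat A $$ (k, i))"
    using v inv(1) by (auto simp: mat_trace_def outer_def scalar_prod_def lessThan_atLeast0 intro!: sum.cong)
  also have "\<dots> = (\<Sum>k<d. v $ k * (\<Sum>i<d. inv_mat A $$ (k, i) * v $ i))"
    by (subst sum.swap) (simp add: sum_distrib_left mult_ac)
  also have "\<dots> = (\<Sum>k<d. if k = 0 then v $ k else 0)" by (intro sum.cong) (auto simp: unit)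
  also have "\<dots> = 1" using v \<open>v $ 0 = 1\<close> by simp
  finally show ?thesis .
qed

section \<open>Estimators along a data path\<close>

text \<open>Every estimator is rewritten below through averages of products of two data coordinates,
  so limits of these averages suffice. At \<open>t = 0\<close> the value is 0.\<close>

definition avg :: "(nat \<Rightarrow> real) \<Rightarrow> nat \<Rightarrow> real" where
  "avg f t = 1 / real t * (\<Sum>l=1..t. f l)"

lemma dim_feat: "dim_vec (feat S x) = card S + 1"
  by (simp add: feat_def)

lemma feat_0: "feat S x $ 0 = 1"
  by (simp add: feat_def)

lemma design_carrier: "design x t S \<in> carrier_mat t (card S + 1)"
  by (rule carrier_matI) (simp_all add: design_def del: upt_Suc)

lemma design_index:
  assumes "k < t" "i < card S + 1"
  shows "design x t S $$ (k, i) = feat S (x (Suc k)) $ i"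
  using assms by (simp add: design_def mat_of_rows_index del: upt_Suc)

text \<open>Matrix rows are counted from 0 and samples from 1.\<close>

lemma sum_shift_1: "(\<Sum>k\<in>{0..<t}. f (Suc k)) = (\<Sum>l=1..t. f l)"
  by (simp add: sum.atLeast1_atMost_eq lessThan_atLeast0)

abbreviation gram :: "(nat \<Rightarrow> nat \<Rightarrow> real) \<Rightarrow> nat \<Rightarrow> nat set \<Rightarrow> real mat" where
  "gram x t S \<equiv> transpose_mat (design x t S) * design x t S"

lemma gram_carrier: "gram x t S \<in> carrier_mat (card S + 1) (card S + 1)"
  using design_carrier[of x t S] by auto

lemma gram_index:
  assumes "i < card S + 1" "j < card S + 1"
  shows "gram x t S $$ (i, j) = (\<Sum>l=1..t. feat S (x l) $ i * feat S (x l) $ j)"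
proof -
  have "gram x t S $$ (i, j) = (\<Sum>k\<in>{0..<t}. feat S (x (Suc k)) $ i * feat S (x (Suc k)) $ j)"
    using assms carrier_matD[OF design_carrier[of x t S]]
    by (auto simp: scalar_prod_def design_index intro!: sum.cong)
  then show ?thesis by (simp only: sum_shift_1[of "\<lambda>l. feat S (x l) $ i * feat S (x l) $ j"])
qed

lemma transpose_design_mult_vec_index:
  assumes "i < card S + 1"
  shows "(transpose_mat (design x t S) *\<^sub>v vec_of_list (map y [1..<t + 1])) $ i = (\<Sum>l=1..t. feat S (x l) $ i * y l)"
proof -
  have y: "vec_of_list (map y [Suc 0..<Suc t]) $ k = y (Suc k)" if "k < t" for k
    unfolding vec_of_list_index using that by (simp del: upt_Suc)
  have "(transpose_mat (design x t S) *\<^sub>v vec_of_list (map y [1..<t + 1])) $ i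
      = (\<Sum>k\<in>{0..<t}. feat S (x (Suc k)) $ i * y (Suc k))"
    using assms carrier_matD[OF design_carrier[of x t S]]
    by (auto simp: scalar_prod_def design_index y simp del: upt_Suc vec_of_list_map intro!: sum.cong)
  then show ?thesis by (simp only: sum_shift_1[of "\<lambda>l. feat S (x l) $ i * y l"])
qed

text \<open>The factor \<open>feat S (x l) $ 0\<close>, which is 1, turns a first moment into entry
  \<open>(i, 0)\<close> of the second moment matrix. One family of limits then covers means and
  covariances alike.\<close>

lemma mean_hat_avg: "i < card S + 1 \<Longrightarrow> mean_hat x t S $ i = avg (\<lambda>l. feat S (x l) $ i * feat S (x l) $ 0) t"
  by (simp add: mean_hat_def avg_def feat_0)

text \<open>The sample mean is column 0 of the normalised Gram matrix, so
  \<open>trace_outer_inv_mat\<close> applies and \<open>k2_hat\<close> reduces to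
  \<open>var_hat\<close> plus the regularisation.\<close>

lemma trace_term_hat:
  assumes "det (gram x t S) \<noteq> 0" "0 < t"
  shows "mat_trace (outer (mean_hat x t S) (mean_hat x t S) * moment_inv_hat x t S) = 1"
  unfolding moment_inv_hat_def
proof (rule trace_outer_inv_mat)
  show "(1 / real t) \<cdot>\<^sub>m gram x t S \<in> carrier_mat (card S + 1) (card S + 1)" using gram_carrier by simp
  show "det ((1 / real t) \<cdot>\<^sub>m gram x t S) \<noteq> 0" using assms by simp
  show "mean_hat x t S $ 0 = 1" using assms by (simp add: mean_hat_def feat_0)
  fix i assume i: "i < card S + 1"
  then show "mean_hat x t S $ i = ((1 / real t) \<cdot>\<^sub>m gram x t S) $$ (i, 0)"
    using carrier_matD[OF gram_carrier[of x t S]] gram_index[OF i, of 0 x t]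
    by (simp add: mean_hat_avg avg_def del: index_mult_mat)
qed (auto simp: mean_hat_def)

lemma beta_hat_carrier:
  assumes "det (gram x t S) \<noteq> 0"
  shows "beta_hat x y t S \<in> carrier_vec (card S + 1)"
  using inv_mat_nonsingular(1)[OF gram_carrier assms] by (intro carrier_vecI) (simp add: beta_hat_def)

text \<open>The factors \<open>1 / t\<close> and \<open>t\<close> cancel between the inverse and the
  right-hand side. In this form both factors of each summand converge.\<close>

lemma beta_hat_index:
  assumes det: "det (gram x t S) \<noteq> 0" and t: "0 < t" and i: "i < card S + 1"
  shows "beta_hat x y t S $ i = (\<Sum>j<card S + 1. moment_inv_hat x t S $$ (i, j) * avg (\<lambda>l. feat S (x l) $ j * y l) t)"
proof -
  let ?d = "card S + 1" and ?w = "vec_of_list (map y [1..<t + 1])"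
  note inv = inv_mat_nonsingular(1)[OF gram_carrier det]
  have Z: "transpose_mat (design x t S) \<in> carrier_mat ?d t" using design_carrier by simp
  have w: "?w \<in> carrier_vec t" by (intro carrier_vecI) (simp del: upt_Suc)
  have beta: "beta_hat x y t S = inv_mat (gram x t S) *\<^sub>v (transpose_mat (design x t S) *\<^sub>v ?w)"
    unfolding beta_hat_def by (rule assoc_mult_mat_vec[OF inv Z w])
  have "beta_hat x y t S $ i = (\<Sum>j<?d. inv_mat (gram x t S) $$ (i, j) * (transpose_mat (design x t S) *\<^sub>v ?w) $ j)"
    unfolding beta by (rule index_mult_mat_vec_sum[OF mult_mat_vec_carrier[OF Z w] inv i])
  also have "\<dots> = (\<Sum>j<?d. inv_mat (gram x t S) $$ (i, j) * (\<Sum>l=1..t. feat S (x l) $ j * y l))"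
    by (rule sum.cong[OF refl]) (simp only: lessThan_iff transpose_design_mult_vec_index)
  also have "\<dots> = (\<Sum>j<?d. moment_inv_hat x t S $$ (i, j) * avg (\<lambda>l. feat S (x l) $ j * y l) t)"
    unfolding moment_inv_hat_def using t i inv
    by (intro sum.cong) (simp_all add: inv_mat_smult[OF gram_carrier det] avg_def carrier_matD[OF inv])
  finally show ?thesis .
qed

text \<open>A scaled sum of squares, from which the nonnegativity of \<open>k1_hat\<close> is read
  off.\<close>

lemma quad_cov_hat:
  assumes v: "v \<in> carrier_vec (card S + 1)"
  shows "v \<bullet> (cov_hat x t S *\<^sub>v v) =
    1 / (real t - 1) * (\<Sum>l=1..t. (\<Sum>i<card S + 1. v $ i * (feat S (x l) $ i - mean_hat x t S $ i))\<^sup>2)"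
proof -
  let ?d = "card S + 1" and ?f = "\<lambda>l i. feat S (x l) $ i - mean_hat x t S $ i"
  have "v \<bullet> (cov_hat x t S *\<^sub>v v) = (\<Sum>i<?d. \<Sum>j<?d. v $ i * v $ j * cov_hat x t S $$ (i, j))"
    using v by (intro scalar_prod_mult_mat_vec) (auto simp: cov_hat_def)
  also have "\<dots> = (\<Sum>i<?d. \<Sum>j<?d. \<Sum>l=1..t. 1 / (real t - 1) * ((v $ i * ?f l i) * (v $ j * ?f l j)))"
    by (intro sum.cong refl) (simp add: cov_hat_def sum_distrib_left mult_ac)
  also have "\<dots> = (\<Sum>l=1..t. \<Sum>i<?d. \<Sum>j<?d. 1 / (real t - 1) * ((v $ i * ?f l i) * (v $ j * ?f l j)))"
    by (subst sum.swap, subst sum.swap[of _ "{1..t}" "{..<?d}"]) (rule refl)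
  also have "\<dots> = 1 / (real t - 1) * (\<Sum>l=1..t. (\<Sum>i<?d. v $ i * ?f l i)\<^sup>2)"
    unfolding power2_eq_square sum_product by (simp only: sum_distrib_left)
  finally show ?thesis .
qed

lemma k1_hat_ge_0:
  assumes "det (gram x t S) \<noteq> 0" "2 \<le> t" "0 \<le> c_ept c S"
  shows "0 \<le> k1_hat c x y t S"
  unfolding k1_hat_def quad_cov_hat[OF beta_hat_carrier[OF assms(1)]]
  using assms by (intro mult_nonneg_nonneg sum_nonneg) auto

text \<open>The residual variance may vanish, so strict positivity comes from the regularisation
  \<open>\<alpha> t\<close>. The bound on \<open>t\<close> keeps the number \<open>t - s - 1\<close>
  of degrees of freedom at least 1.\<close>

lemma k2_hat_gt_0:
  assumes "det (gram x t S) \<noteq> 0" "card S + 2 \<le> t" "0 < \<alpha> t"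
  shows "0 < k2_hat \<alpha> x y t S"
proof -
  have "0 \<le> var_hat x y t S"
    unfolding var_hat_def using assms by (intro mult_nonneg_nonneg sum_nonneg) auto
  then show ?thesis using assms by (simp add: k2_hat_def trace_term_hat)
qed

text \<open>Mean of the product minus product of the means; the factor in front converts the average
  into the normalisation by \<open>t - 1\<close>.\<close>

lemma cov_hat_index:
  assumes "i < card S + 1" "j < card S + 1" "2 \<le> t"
  shows "cov_hat x t S $$ (i, j) = real t / (real t - 1) *
    (avg (\<lambda>l. feat S (x l) $ i * feat S (x l) $ j) t
     - avg (\<lambda>l. feat S (x l) $ i * feat S (x l) $ 0) t * avg (\<lambda>l. feat S (x l) $ j * feat S (x l) $ 0) t)"
proof -
  define p q where "p = (\<lambda>l. feat S (x l) $ i)" and "q = (\<lambda>l. feat S (x l) $ j)"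
  define mp mq where "mp = avg p t" and "mq = avg q t"
  have sums: "(\<Sum>l=1..t. p l) = real t * mp" "(\<Sum>l=1..t. q l) = real t * mq"
    using assms by (auto simp: mp_def mq_def avg_def)
  have "(\<Sum>l=1..t. (p l - mp) * (q l - mq)) = (\<Sum>l=1..t. p l * q l - mq * p l - mp * q l + mp * mq)"
    by (intro sum.cong) (auto simp: algebra_simps)
  also have "\<dots> = (\<Sum>l=1..t. p l * q l) - mq * (\<Sum>l=1..t. p l) - mp * (\<Sum>l=1..t. q l) + real t * (mp * mq)"
    by (simp add: sum.distrib sum_subtractf sum_distrib_left)
  also have "\<dots> = real t * (avg (\<lambda>l. p l * q l) t - mp * mq)"
    unfolding sums using assms by (simp add: avg_def algebra_simps)
  finally show ?thesis
    using assms by (simp add: cov_hat_def mean_hat_avg feat_0 p_def q_def mp_def mq_def)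
qed

text \<open>Expanding the squared residuals leaves only second-moment averages and the coordinates
  of \<open>beta_hat\<close>, so the limit can be taken term by term.\<close>

lemma var_hat_avg:
  assumes b: "beta_hat x y t S \<in> carrier_vec (card S + 1)" and t: "0 < t"
  defines "d \<equiv> card S + 1" and "b \<equiv> beta_hat x y t S"
  shows "var_hat x y t S = real t / (real t - real d) *
    (avg (\<lambda>l. y l * y l) t - 2 * (\<Sum>i<d. b $ i * avg (\<lambda>l. feat S (x l) $ i * y l) t)
     + (\<Sum>i<d. \<Sum>j<d. b $ i * b $ j * avg (\<lambda>l. feat S (x l) $ i * feat S (x l) $ j) t))"
proof -
  let ?f = "\<lambda>l i. feat S (x l) $ i"
  have dim_b: "dim_vec b = d" using b unfolding b_def d_def by (rule carrier_vecD)
  have "(y l - feat S (x l) \<bullet> b)\<^sup>2 = y l * y l - 2 * (\<Sum>i<d. b $ i * (?f l i * y l))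
      + (\<Sum>i<d. \<Sum>j<d. b $ i * b $ j * (?f l i * ?f l j))" for l
  proof -
    have prod: "feat S (x l) \<bullet> b = (\<Sum>i<d. b $ i * ?f l i)"
      unfolding scalar_prod_def dim_b by (simp add: mult.commute atLeast0LessThan)
    have sq: "(\<Sum>i<d. b $ i * ?f l i)\<^sup>2 = (\<Sum>i<d. \<Sum>j<d. b $ i * b $ j * (?f l i * ?f l j))"
      by (simp add: power2_eq_square sum_product mult_ac)
    have cross: "(\<Sum>i<d. b $ i * ?f l i) * y l = (\<Sum>i<d. b $ i * (?f l i * y l))"
      by (simp only: sum_distrib_right mult.assoc)
    have "(y l - s)\<^sup>2 = y l * y l - 2 * (s * y l) + s\<^sup>2" for s
      by (simp add: power2_eq_square algebra_simps)
    then show ?thesis unfolding prod by (simp only: sq cross)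
  qed
  then have "(\<Sum>l=1..t. (y l - feat S (x l) \<bullet> b)\<^sup>2) = (\<Sum>l=1..t. y l * y l)
      - 2 * (\<Sum>l=1..t. \<Sum>i<d. b $ i * (?f l i * y l)) + (\<Sum>l=1..t. \<Sum>i<d. \<Sum>j<d. b $ i * b $ j * (?f l i * ?f l j))"
    by (simp add: sum.distrib sum_subtractf sum_distrib_left)
  also have "(\<Sum>l=1..t. \<Sum>i<d. b $ i * (?f l i * y l)) = (\<Sum>i<d. b $ i * (\<Sum>l=1..t. ?f l i * y l))"
    by (subst sum.swap) (simp add: sum_distrib_left)
  also have "(\<Sum>l=1..t. \<Sum>i<d. \<Sum>j<d. b $ i * b $ j * (?f l i * ?f l j))
      = (\<Sum>i<d. \<Sum>j<d. b $ i * b $ j * (\<Sum>l=1..t. ?f l i * ?f l j))"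
    by (subst sum.swap, subst sum.swap[of _ "{..<d}" "{1..t}"]) (simp add: sum_distrib_left)
  finally have sum_eq: "(\<Sum>l=1..t. (y l - feat S (x l) \<bullet> b)\<^sup>2) = (\<Sum>l=1..t. y l * y l)
      - 2 * (\<Sum>i<d. b $ i * (\<Sum>l=1..t. ?f l i * y l))
      + (\<Sum>i<d. \<Sum>j<d. b $ i * b $ j * (\<Sum>l=1..t. ?f l i * ?f l j))" .
  \<comment> \<open>The outer factor is moved onto the primed functions, which are the averages;
    with \<open>r = t\<close> it cancels the \<open>1 / t\<close> in \<open>avg\<close>.\<close>
  have scale: "r * (u - 2 * (\<Sum>i<d. v i * v' i) + (\<Sum>i<d. \<Sum>j<d. w i j * w' i j))
      = r * u - 2 * (\<Sum>i<d. v i * (r * v' i)) + (\<Sum>i<d. \<Sum>j<d. w i j * (r * w' i j))"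
    for r u :: real and v v' w w'
    by (simp add: distrib_left right_diff_distrib sum_distrib_left mult.left_commute)
  have avg: "real t * avg f t = (\<Sum>l=1..t. f l)" for f using t by (simp add: avg_def)
  have "(\<Sum>l=1..t. (y l - feat S (x l) \<bullet> b)\<^sup>2) = real t *
    (avg (\<lambda>l. y l * y l) t - 2 * (\<Sum>i<d. b $ i * avg (\<lambda>l. ?f l i * y l) t)
     + (\<Sum>i<d. \<Sum>j<d. b $ i * b $ j * avg (\<lambda>l. ?f l i * ?f l j) t))"
    unfolding scale avg by (rule sum_eq)
  moreover have "real t - real (card S) - 1 = real t - real d" by (simp add: d_def)
  ultimately have "var_hat x y t S = 1 / (real t - real d) * (real t *
    (avg (\<lambda>l. y l * y l) t - 2 * (\<Sum>i<d. b $ i * avg (\<lambda>l. ?f l i * y l) t)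
     + (\<Sum>i<d. \<Sum>j<d. b $ i * b $ j * avg (\<lambda>l. ?f l i * ?f l j) t)))"
    unfolding var_hat_def b_def[symmetric] by (simp only:)
  then show ?thesis by (simp only: mult.assoc[symmetric] times_divide_eq_left mult_1)
qed

section \<open>Limits of the estimators\<close>

lemma tendsto_ratio_1: "(\<lambda>t. real t / (real t - k)) \<longlonglongrightarrow> 1"
proof -
  have "(\<lambda>t. 1 / (1 - k / real t)) \<longlonglongrightarrow> 1 / (1 - 0)"
    by (intro tendsto_divide tendsto_diff tendsto_const lim_const_over_n) auto
  moreover have "\<forall>\<^sub>F t in sequentially. 1 / (1 - k / real t) = real t / (real t - k)"
    using eventually_gt_at_top[of 0]
  proof eventually_elim
    case (elim t)
    then have "1 - k / real t = (real t - k) / real t" by (simp add: diff_divide_distrib)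
    then show ?case by simp
  qed
  ultimately have "(\<lambda>t. real t / (real t - k)) \<longlonglongrightarrow> 1 / (1 - 0)" by (rule Lim_transform_eventually)
  then show ?thesis by simp
qed

text \<open>Hypothesis \<open>xy\<close> is the normal equation in the limit, so
  \<open>beta_hat\<close> tends to the inverse of \<open>L\<close> applied to
  \<open>L *\<^sub>v b\<close>, that is to \<open>b\<close>. The bias corrections
  \<open>t / (t - 1)\<close> and \<open>t / (t - d)\<close> tend to 1. The residual variance tends
  to \<open>q\<close> minus twice plus once the form
  \<open>b \<bullet> (L *\<^sub>v b)\<close>.\<close>

lemma estimators_converge:
  fixes S :: "nat set" and x :: "nat \<Rightarrow> nat \<Rightarrow> real" and y :: "nat \<Rightarrow> real"
  defines "d \<equiv> card S + 1"
  assumes det: "\<And>t. N \<le> t \<Longrightarrow> det (gram x t S) \<noteq> 0"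
    and L: "L \<in> carrier_mat d d" "det L \<noteq> 0" and b: "b \<in> carrier_vec d"
    and xx: "\<And>i j. i < d \<Longrightarrow> j < d \<Longrightarrow> avg (\<lambda>l. feat S (x l) $ i * feat S (x l) $ j) \<longlonglongrightarrow> L $$ (i, j)"
    and xy: "\<And>i. i < d \<Longrightarrow> avg (\<lambda>l. feat S (x l) $ i * y l) \<longlonglongrightarrow> (L *\<^sub>v b) $ i"
    and yy: "avg (\<lambda>l. y l * y l) \<longlonglongrightarrow> q"
  shows "(\<lambda>t. beta_hat x y t S \<bullet> (cov_hat x t S *\<^sub>v beta_hat x y t S)) \<longlonglongrightarrow>
      (\<Sum>i<d. \<Sum>j<d. b $ i * b $ j * (L $$ (i, j) - L $$ (i, 0) * L $$ (j, 0)))"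
    and "(\<lambda>t. var_hat x y t S) \<longlonglongrightarrow> q - b \<bullet> (L *\<^sub>v b)"
proof -
  have gram_lim: "(\<lambda>t. ((1 / real t) \<cdot>\<^sub>m gram x t S) $$ (i, j)) \<longlonglongrightarrow> L $$ (i, j)" if "i < d" "j < d" for i j
  proof -
    have "((1 / real t) \<cdot>\<^sub>m gram x t S) $$ (i, j) = avg (\<lambda>l. feat S (x l) $ i * feat S (x l) $ j) t" for t
      using that carrier_matD[OF gram_carrier[of x t S]] gram_index[of i S j x t]
      by (simp add: d_def avg_def del: index_mult_mat)
    then show ?thesis using xx[OF that] by simp
  qed
  have inv_lim: "(\<lambda>t. moment_inv_hat x t S $$ (i, j)) \<longlonglongrightarrow> inv_mat L $$ (i, j)" if "i < d" "j < d" for i j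
    unfolding moment_inv_hat_def
    by (rule tendsto_inv_mat[OF _ L gram_lim that]) (use gram_carrier in \<open>auto simp: d_def\<close>)
  have large: "\<forall>\<^sub>F t in sequentially. N \<le> t \<and> 2 \<le> t"
    by (intro eventually_conj eventually_ge_at_top)
  have beta_lim: "(\<lambda>t. beta_hat x y t S $ i) \<longlonglongrightarrow> b $ i" if i: "i < d" for i
  proof -
    note inv = inv_mat_nonsingular[OF L]
    have Lb: "L *\<^sub>v b \<in> carrier_vec d" using L b by simp
    have "inv_mat L *\<^sub>v (L *\<^sub>v b) = (inv_mat L * L) *\<^sub>v b"
      by (rule assoc_mult_mat_vec[OF inv(1) L(1) b, symmetric])
    then have "inv_mat L *\<^sub>v (L *\<^sub>v b) = b" using inv(3) b by simp
    then have "(\<Sum>j<d. inv_mat L $$ (i, j) * (L *\<^sub>v b) $ j) = b $ i"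
      using index_mult_mat_vec_sum[OF Lb inv(1) i] by simp
    moreover have "(\<lambda>t. \<Sum>j<d. moment_inv_hat x t S $$ (i, j) * avg (\<lambda>l. feat S (x l) $ j * y l) t)
        \<longlonglongrightarrow> (\<Sum>j<d. inv_mat L $$ (i, j) * (L *\<^sub>v b) $ j)"
      using i by (intro tendsto_sum tendsto_mult inv_lim xy) auto
    ultimately have lim: "(\<lambda>t. \<Sum>j<d. moment_inv_hat x t S $$ (i, j) * avg (\<lambda>l. feat S (x l) $ j * y l) t) \<longlonglongrightarrow> b $ i"
      by simp
    have "\<forall>\<^sub>F t in sequentially. (\<Sum>j<d. moment_inv_hat x t S $$ (i, j) * avg (\<lambda>l. feat S (x l) $ j * y l) t)
        = beta_hat x y t S $ i"
      using large by eventually_elim (use i det in \<open>simp add: beta_hat_index d_def del: sum.lessThan_Suc\<close>)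
    with lim show ?thesis by (rule Lim_transform_eventually)
  qed
  have cov_lim: "(\<lambda>t. cov_hat x t S $$ (i, j)) \<longlonglongrightarrow> L $$ (i, j) - L $$ (i, 0) * L $$ (j, 0)"
    if ij: "i < d" "j < d" for i j
  proof -
    have "(\<lambda>t. real t / (real t - 1) *
      (avg (\<lambda>l. feat S (x l) $ i * feat S (x l) $ j) t
       - avg (\<lambda>l. feat S (x l) $ i * feat S (x l) $ 0) t * avg (\<lambda>l. feat S (x l) $ j * feat S (x l) $ 0) t))
      \<longlonglongrightarrow> 1 * (L $$ (i, j) - L $$ (i, 0) * L $$ (j, 0))"
      using ij by (intro tendsto_mult tendsto_diff tendsto_ratio_1 xx) auto
    moreover have "\<forall>\<^sub>F t in sequentially. real t / (real t - 1) *
      (avg (\<lambda>l. feat S (x l) $ i * feat S (x l) $ j) t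
       - avg (\<lambda>l. feat S (x l) $ i * feat S (x l) $ 0) t * avg (\<lambda>l. feat S (x l) $ j * feat S (x l) $ 0) t)
      = cov_hat x t S $$ (i, j)"
      using large by eventually_elim (use ij in \<open>simp add: cov_hat_index d_def\<close>)
    ultimately show ?thesis unfolding mult_1 by (rule Lim_transform_eventually)
  qed
  have "(\<lambda>t. \<Sum>i<d. \<Sum>j<d. beta_hat x y t S $ i * beta_hat x y t S $ j * cov_hat x t S $$ (i, j)) \<longlonglongrightarrow>
      (\<Sum>i<d. \<Sum>j<d. b $ i * b $ j * (L $$ (i, j) - L $$ (i, 0) * L $$ (j, 0)))"
    by (intro tendsto_sum tendsto_mult beta_lim cov_lim) auto
  moreover have "\<forall>\<^sub>F t in sequentially.
      (\<Sum>i<d. \<Sum>j<d. beta_hat x y t S $ i * beta_hat x y t S $ j * cov_hat x t S $$ (i, j))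
      = beta_hat x y t S \<bullet> (cov_hat x t S *\<^sub>v beta_hat x y t S)"
    using large
    by eventually_elim
      (rule scalar_prod_mult_mat_vec[symmetric], use beta_hat_carrier det in \<open>auto simp: d_def cov_hat_def\<close>)
  ultimately show "(\<lambda>t. beta_hat x y t S \<bullet> (cov_hat x t S *\<^sub>v beta_hat x y t S)) \<longlonglongrightarrow>
      (\<Sum>i<d. \<Sum>j<d. b $ i * b $ j * (L $$ (i, j) - L $$ (i, 0) * L $$ (j, 0)))"
    by (rule Lim_transform_eventually)
  have "(\<lambda>t. real t / (real t - real d) *
    (avg (\<lambda>l. y l * y l) t - 2 * (\<Sum>i<d. beta_hat x y t S $ i * avg (\<lambda>l. feat S (x l) $ i * y l) t)
     + (\<Sum>i<d. \<Sum>j<d. beta_hat x y t S $ i * beta_hat x y t S $ j * avg (\<lambda>l. feat S (x l) $ i * feat S (x l) $ j) t)))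
    \<longlonglongrightarrow> 1 * (q - 2 * (\<Sum>i<d. b $ i * (L *\<^sub>v b) $ i) + (\<Sum>i<d. \<Sum>j<d. b $ i * b $ j * L $$ (i, j)))"
    by (intro tendsto_mult tendsto_add tendsto_diff tendsto_sum tendsto_const tendsto_ratio_1 beta_lim xx xy yy) auto
  moreover have "(\<Sum>i<d. b $ i * (L *\<^sub>v b) $ i) = b \<bullet> (L *\<^sub>v b)"
    using carrier_matD[OF L(1)] by (simp add: scalar_prod_def atLeast0LessThan)
  moreover have "(\<Sum>i<d. \<Sum>j<d. b $ i * b $ j * L $$ (i, j)) = b \<bullet> (L *\<^sub>v b)"
    by (rule scalar_prod_mult_mat_vec[OF b L(1), symmetric])
  ultimately have lim: "(\<lambda>t. real t / (real t - real d) *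
    (avg (\<lambda>l. y l * y l) t - 2 * (\<Sum>i<d. beta_hat x y t S $ i * avg (\<lambda>l. feat S (x l) $ i * y l) t)
     + (\<Sum>i<d. \<Sum>j<d. beta_hat x y t S $ i * beta_hat x y t S $ j * avg (\<lambda>l. feat S (x l) $ i * feat S (x l) $ j) t)))
    \<longlonglongrightarrow> q - b \<bullet> (L *\<^sub>v b)" by simp
  have "\<forall>\<^sub>F t in sequentially. real t / (real t - real d) *
    (avg (\<lambda>l. y l * y l) t - 2 * (\<Sum>i<d. beta_hat x y t S $ i * avg (\<lambda>l. feat S (x l) $ i * y l) t)
     + (\<Sum>i<d. \<Sum>j<d. beta_hat x y t S $ i * beta_hat x y t S $ j * avg (\<lambda>l. feat S (x l) $ i * feat S (x l) $ j) t))
    = var_hat x y t S"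
    using large
    by eventually_elim (unfold d_def, rule var_hat_avg[symmetric], use beta_hat_carrier det in auto)
  with lim show "(\<lambda>t. var_hat x y t S) \<longlonglongrightarrow> q - b \<bullet> (L *\<^sub>v b)" by (rule Lim_transform_eventually)
qed

section \<open>Moments and the strong law\<close>

text \<open>A single term of the exponential series is at most the whole series. This turns
  exponential integrability into moments of every order.\<close>

lemma power_le_fact_mult_exp:
  assumes "0 \<le> (u :: real)"
  shows "u ^ k \<le> fact k * exp u"
proof -
  have "(\<Sum>n\<in>{k}. u ^ n /\<^sub>R fact n) \<le> (\<Sum>n. u ^ n /\<^sub>R fact n)"
    using assms by (intro sum_le_suminf summable_exp_generic) auto
  then show ?thesis by (simp add: exp_def field_simps)
qed

text \<open>On a probability space this is the intersection of all L^p spaces. It is closed under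
  sums and products, so products of two data coordinates again have the fourth moments that the
  strong law asks for.\<close>

definition all_moments :: "'p measure \<Rightarrow> ('p \<Rightarrow> real) \<Rightarrow> bool" where
  "all_moments P f \<longleftrightarrow> f \<in> borel_measurable P \<and> (\<forall>k. integrable P (\<lambda>\<omega>. f \<omega> ^ k))"

lemma all_moments_measurable: "all_moments P f \<Longrightarrow> f \<in> borel_measurable P"
  by (simp add: all_moments_def)

lemma all_moments_power_integrable: "all_moments P f \<Longrightarrow> integrable P (\<lambda>\<omega>. f \<omega> ^ k)"
  by (simp add: all_moments_def)

lemma all_moments_integrable: "all_moments P f \<Longrightarrow> integrable P f"
  using all_moments_power_integrable[of P f 1] by simp

text \<open>Domination by \<open>f \<omega> ^ (2 * i) + g \<omega> ^ (2 * j)\<close>, in place of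
  the Cauchy-Schwarz inequality.\<close>

lemma all_moments_powers_mult_integrable:
  assumes f: "all_moments P f" and g: "all_moments P g"
  shows "integrable P (\<lambda>\<omega>. f \<omega> ^ i * g \<omega> ^ j)"
proof (rule Bochner_Integration.integrable_bound)
  show "integrable P (\<lambda>\<omega>. f \<omega> ^ (2 * i) + g \<omega> ^ (2 * j))"
    using f g by (intro Bochner_Integration.integrable_add all_moments_power_integrable)
  show "(\<lambda>\<omega>. f \<omega> ^ i * g \<omega> ^ j) \<in> borel_measurable P"
    using f g by (intro borel_measurable_times borel_measurable_power all_moments_measurable)
  have "\<bar>a * b\<bar> \<le> a\<^sup>2 + b\<^sup>2" for a b :: real
  proof -
    have "2 * \<bar>a * b\<bar> \<le> a\<^sup>2 + b\<^sup>2"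
      using sum_squares_bound[of "\<bar>a\<bar>" "\<bar>b\<bar>"] by (simp only: power2_abs abs_mult mult.assoc)
    then show ?thesis using abs_ge_zero[of "a * b"] by linarith
  qed
  then have "norm (f \<omega> ^ i * g \<omega> ^ j) \<le> norm (f \<omega> ^ (2 * i) + g \<omega> ^ (2 * j))" for \<omega>
    by (simp add: power_mult mult.commute[of 2])
  then show "AE \<omega> in P. norm (f \<omega> ^ i * g \<omega> ^ j) \<le> norm (f \<omega> ^ (2 * i) + g \<omega> ^ (2 * j))" by simp
qed

lemma all_moments_mult:
  assumes "all_moments P f" "all_moments P g"
  shows "all_moments P (\<lambda>\<omega>. f \<omega> * g \<omega>)"
  unfolding all_moments_def power_mult_distrib
  using assms by (auto intro: all_moments_powers_mult_integrable borel_measurable_times all_moments_measurable)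

lemma all_moments_add:
  assumes f: "all_moments P f" and g: "all_moments P g"
  shows "all_moments P (\<lambda>\<omega>. f \<omega> + g \<omega>)"
  unfolding all_moments_def binomial_ring mult.assoc
  using all_moments_powers_mult_integrable[OF f g]
  by (intro conjI allI Bochner_Integration.integrable_sum integrable_mult_right borel_measurable_add
      all_moments_measurable[OF f] all_moments_measurable[OF g]) auto

lemma (in prob_space) all_moments_const: "all_moments M (\<lambda>\<omega>. k)"
  by (simp add: all_moments_def)

lemma (in prob_space) all_moments_sum:
  assumes "\<And>i. i \<in> I \<Longrightarrow> all_moments M (f i)"
  shows "all_moments M (\<lambda>\<omega>. \<Sum>i\<in>I. f i \<omega>)"
  using assms by (induction I rule: infinite_finite_induct) (auto intro: all_moments_add all_moments_const)

lemma all_moments_cong_AE: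
  assumes "all_moments P f" "g \<in> borel_measurable P" "AE \<omega> in P. f \<omega> = g \<omega>"
  shows "all_moments P g"
proof -
  have "integrable P (\<lambda>\<omega>. g \<omega> ^ k)" for k
    by (rule integrable_cong_AE_imp[OF all_moments_power_integrable[OF assms(1)]]) (use assms in auto)
  then show ?thesis using assms by (simp add: all_moments_def)
qed

lemma all_moments_bound:
  assumes f: "all_moments P f" and g: "g \<in> borel_measurable P" and le: "\<And>\<omega>. \<bar>g \<omega>\<bar> \<le> f \<omega>"
  shows "all_moments P g"
proof -
  have "integrable P (\<lambda>\<omega>. g \<omega> ^ k)" for k
  proof (rule Bochner_Integration.integrable_bound[OF all_moments_power_integrable[OF f]])
    show "AE \<omega> in P. norm (g \<omega> ^ k) \<le> norm (f \<omega> ^ k)"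
    proof (intro AE_I2)
      fix \<omega>
      have "\<bar>g \<omega>\<bar> \<le> \<bar>f \<omega>\<bar>" using le[of \<omega>] by linarith
      then show "norm (g \<omega> ^ k) \<le> norm (f \<omega> ^ k)" by (simp add: power_abs power_mono)
    qed
  qed (use g in simp)
  then show ?thesis using g by (simp add: all_moments_def)
qed

lemma all_moments_if_psi_norm_finite:
  assumes W: "W \<in> borel_measurable P" and a: "1 \<le> a" and fin: "psi_norm P a W < \<infinity>"
  shows "all_moments P W"
proof -
  obtain C :: real where C: "C > 0" and le: "(\<integral>\<^sup>+\<omega>. ennreal (exp (\<bar>W \<omega>\<bar> powr a / C powr a)) \<partial>P) \<le> 2"
    using fin unfolding psi_norm_def INF_less_iff by auto
  have "integrable P (\<lambda>\<omega>. W \<omega> ^ k)" for k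
  proof (rule integrableI_bounded)
    \<comment> \<open>The factor \<open>C ^ k\<close> undoes the scaling by \<open>C\<close>, the
      factorial comes from the exponential bound, and \<open>exp 1\<close> from the summand 1 in
      \<open>u \<le> 1 + u powr a\<close>.\<close>
    define D where "D = C ^ k * fact k * exp 1"
    have "norm (W \<omega> ^ k) \<le> D * exp (\<bar>W \<omega>\<bar> powr a / C powr a)" for \<omega>
    proof -
      define u where "u = \<bar>W \<omega>\<bar> / C"
      have u: "0 \<le> u" "\<bar>W \<omega>\<bar> = C * u" using C by (auto simp: u_def)
      \<comment> \<open>This is where \<open>1 \<le> a\<close> enters; it treats sub-exponential and
        sub-Gaussian norms together.\<close>
      have "u \<le> 1 + u powr a"
      proof (cases "u \<le> 1")
        case False
        then have "u powr 1 \<le> u powr a" using a by (intro powr_mono) auto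
        then show ?thesis using False by simp
      qed (simp add: add_increasing2)
      have "norm (W \<omega> ^ k) = C ^ k * u ^ k" by (simp add: power_abs u power_mult_distrib)
      also have "\<dots> \<le> C ^ k * (fact k * exp (1 + u powr a))"
      proof (rule mult_left_mono)
        have "u ^ k \<le> fact k * exp u" by (rule power_le_fact_mult_exp[OF u(1)])
        also have "\<dots> \<le> fact k * exp (1 + u powr a)" using \<open>u \<le> 1 + u powr a\<close> by simp
        finally show "u ^ k \<le> fact k * exp (1 + u powr a)" .
      qed (use C in simp)
      also have "u powr a = \<bar>W \<omega>\<bar> powr a / C powr a" using C by (simp add: u_def powr_divide)
      finally show ?thesis by (simp add: D_def exp_add mult_ac)
    qed
    then have "(\<integral>\<^sup>+\<omega>. ennreal (norm (W \<omega> ^ k)) \<partial>P) \<le> (\<integral>\<^sup>+\<omega>. ennreal D * ennreal (exp (\<bar>W \<omega>\<bar> powr a / C powr a)) \<partial>P)"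
      using C by (intro nn_integral_mono) (simp add: D_def flip: ennreal_mult)
    also have "\<dots> = ennreal D * (\<integral>\<^sup>+\<omega>. ennreal (exp (\<bar>W \<omega>\<bar> powr a / C powr a)) \<partial>P)"
      using W by (intro nn_integral_cmult) simp
    also have "\<dots> \<le> ennreal D * 2" using le by (intro mult_left_mono) auto
    also have "\<dots> < \<infinity>" by (simp add: ennreal_mult_less_top)
    finally show "(\<integral>\<^sup>+\<omega>. ennreal (norm (W \<omega> ^ k)) \<partial>P) < \<infinity>" .
  qed (use W in simp)
  then show ?thesis using W by (simp add: all_moments_def)
qed

section \<open>A strong law under bounded fourth moments\<close>

context prob_space
begin

text \<open>The three claims are proved in one induction because the step for the fourth moment uses
  the mean and the second moment of the shorter sum.\<close>

lemma indep_vars_centered_sum_moments: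
  fixes V :: "nat \<Rightarrow> 'a \<Rightarrow> real"
  assumes indep: "indep_vars (\<lambda>_. borel) V {1..}"
    and V: "\<And>l. 1 \<le> l \<Longrightarrow> all_moments M (V l)"
    and mean: "\<And>l. 1 \<le> l \<Longrightarrow> expectation (V l) = 0"
    and C: "1 \<le> C" "\<And>l. 1 \<le> l \<Longrightarrow> expectation (\<lambda>\<omega>. V l \<omega> ^ 2) \<le> C" "\<And>l. 1 \<le> l \<Longrightarrow> expectation (\<lambda>\<omega>. V l \<omega> ^ 4) \<le> C"
  defines "Q \<equiv> \<lambda>t \<omega>. \<Sum>l=1..t. V l \<omega>"
  shows "expectation (Q t) = 0 \<and> expectation (\<lambda>\<omega>. Q t \<omega> ^ 2) \<le> real t * C \<and>
    expectation (\<lambda>\<omega>. Q t \<omega> ^ 4) \<le> 3 * (real t)\<^sup>2 * C\<^sup>2"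
proof (induction t)
  case 0
  show ?case by (simp add: Q_def)
next
  case (Suc t)
  let ?V = "V (Suc t)"
  have Vm: "all_moments M ?V" using V by simp
  have Qm: "all_moments M (Q t)" unfolding Q_def using V by (intro all_moments_sum) auto
  have "insert (Suc t) {1..t} \<subseteq> {1..}" by auto
  from indep_vars_sum[OF _ _ indep_vars_subset[OF indep this]]
  have ind: "indep_var borel ?V borel (Q t)" by (simp add: Q_def)
  \<comment> \<open>The new summand is independent of the earlier ones, so mixed moments
    factor.\<close>
  have prod: "expectation (\<lambda>\<omega>. ?V \<omega> ^ i * Q t \<omega> ^ j) = expectation (\<lambda>\<omega>. ?V \<omega> ^ i) * expectation (\<lambda>\<omega>. Q t \<omega> ^ j)" for i j
  proof -
    have "indep_var borel ((\<lambda>x. x ^ i) \<circ> ?V) borel ((\<lambda>x. x ^ j) \<circ> Q t)"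
      by (rule indep_var_compose[OF ind]) auto
    from indep_var_lebesgue_integral[OF this]
    show ?thesis using Vm Qm by (simp add: comp_def all_moments_power_integrable)
  qed
  note int = all_moments_powers_mult_integrable[OF Vm Qm]
  have QS: "Q (Suc t) \<omega> = ?V \<omega> + Q t \<omega>" for \<omega> by (simp add: Q_def)
  have V0: "expectation ?V = 0" and Q0: "expectation (Q t) = 0" using mean Suc by auto
  have V2: "expectation (\<lambda>\<omega>. ?V \<omega> ^ 2) \<le> C" and V4: "expectation (\<lambda>\<omega>. ?V \<omega> ^ 4) \<le> C" using C by auto
  have Q2: "expectation (\<lambda>\<omega>. Q t \<omega> ^ 2) \<le> real t * C" and Q4: "expectation (\<lambda>\<omega>. Q t \<omega> ^ 4) \<le> 3 * (real t)\<^sup>2 * C\<^sup>2"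
    using Suc by auto
  have "expectation (Q (Suc t)) = 0"
    unfolding QS using V0 Q0 Vm Qm by (simp add: all_moments_integrable)
  moreover have "expectation (\<lambda>\<omega>. Q (Suc t) \<omega> ^ 2) \<le> real (Suc t) * C"
  proof -
    \<comment> \<open>The exponents 0 and 1 are kept visible so that every term has the shape
      required by \<open>prod\<close> and \<open>int\<close>.\<close>
    have "expectation (\<lambda>\<omega>. Q (Suc t) \<omega> ^ 2) =
      expectation (\<lambda>\<omega>. ?V \<omega> ^ 2 * Q t \<omega> ^ 0 + 2 * (?V \<omega> ^ 1 * Q t \<omega> ^ 1) + ?V \<omega> ^ 0 * Q t \<omega> ^ 2)"
      by (simp add: QS power2_eq_square algebra_simps)
    also have "\<dots> = expectation (\<lambda>\<omega>. ?V \<omega> ^ 2 * Q t \<omega> ^ 0) + 2 * expectation (\<lambda>\<omega>. ?V \<omega> ^ 1 * Q t \<omega> ^ 1)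
        + expectation (\<lambda>\<omega>. ?V \<omega> ^ 0 * Q t \<omega> ^ 2)"
      by (subst Bochner_Integration.integral_add, (intro Bochner_Integration.integrable_add integrable_mult_right int)+)+ simp
    also have "\<dots> = expectation (\<lambda>\<omega>. ?V \<omega> ^ 2) + expectation (\<lambda>\<omega>. Q t \<omega> ^ 2)"
      unfolding prod using V0 by (simp add: prob_space)
    finally show ?thesis using V2 Q2 by (simp add: algebra_simps)
  qed
  moreover have "expectation (\<lambda>\<omega>. Q (Suc t) \<omega> ^ 4) \<le> 3 * (real (Suc t))\<^sup>2 * C\<^sup>2"
  proof -
    have "expectation (\<lambda>\<omega>. Q (Suc t) \<omega> ^ 4) =
      expectation (\<lambda>\<omega>. ?V \<omega> ^ 4 * Q t \<omega> ^ 0 + 4 * (?V \<omega> ^ 3 * Q t \<omega> ^ 1) + 6 * (?V \<omega> ^ 2 * Q t \<omega> ^ 2)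
        + 4 * (?V \<omega> ^ 1 * Q t \<omega> ^ 3) + ?V \<omega> ^ 0 * Q t \<omega> ^ 4)"
      by (simp add: QS power4_eq_xxxx power3_eq_cube power2_eq_square algebra_simps)
    also have "\<dots> = expectation (\<lambda>\<omega>. ?V \<omega> ^ 4 * Q t \<omega> ^ 0) + 4 * expectation (\<lambda>\<omega>. ?V \<omega> ^ 3 * Q t \<omega> ^ 1)
        + 6 * expectation (\<lambda>\<omega>. ?V \<omega> ^ 2 * Q t \<omega> ^ 2) + 4 * expectation (\<lambda>\<omega>. ?V \<omega> ^ 1 * Q t \<omega> ^ 3)
        + expectation (\<lambda>\<omega>. ?V \<omega> ^ 0 * Q t \<omega> ^ 4)"
      by (subst Bochner_Integration.integral_add, (intro Bochner_Integration.integrable_add integrable_mult_right int)+)+ simp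
    \<comment> \<open>Each term with an odd exponent contains the mean of \<open>?V\<close> or of
      \<open>Q t\<close> as a factor and vanishes.\<close>
    also have "\<dots> = expectation (\<lambda>\<omega>. ?V \<omega> ^ 4) + 6 * (expectation (\<lambda>\<omega>. ?V \<omega> ^ 2) * expectation (\<lambda>\<omega>. Q t \<omega> ^ 2))
        + expectation (\<lambda>\<omega>. Q t \<omega> ^ 4)"
      unfolding prod using V0 Q0 by (simp add: prob_space)
    also have "\<dots> \<le> C + 6 * (C * (real t * C)) + 3 * (real t)\<^sup>2 * C\<^sup>2"
      using V2 V4 Q2 Q4 C(1) by (intro add_mono mult_left_mono mult_mono) auto
    \<comment> \<open>By \<open>1 \<le> C\<close>. The coefficient of the square of \<open>C\<close>
      is now \<open>1 + 6 t + 3 t^2\<close>, which is at most \<open>3 (t + 1)^2\<close>.\<close>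
    also have "\<dots> \<le> C\<^sup>2 + 6 * (C * (real t * C)) + 3 * (real t)\<^sup>2 * C\<^sup>2"
      using C(1) self_le_power[of C 2] by simp
    also have "\<dots> \<le> 3 * (real (Suc t))\<^sup>2 * C\<^sup>2"
      by (simp add: power2_eq_square algebra_simps)
    finally show ?thesis .
  qed
  ultimately show ?case by blast
qed

text \<open>The fourth moment of the average is of order \<open>1 / t^2\<close>, hence summable. So
  the series of fourth powers is finite almost surely, and its terms tend to 0.\<close>

lemma AE_averages_tendsto_0:
  fixes V :: "nat \<Rightarrow> 'a \<Rightarrow> real"
  assumes indep: "indep_vars (\<lambda>_. borel) V {1..}"
    and V: "\<And>l. 1 \<le> l \<Longrightarrow> all_moments M (V l)"
    and mean: "\<And>l. 1 \<le> l \<Longrightarrow> expectation (V l) = 0"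
    and C: "1 \<le> C" "\<And>l. 1 \<le> l \<Longrightarrow> expectation (\<lambda>\<omega>. V l \<omega> ^ 2) \<le> C" "\<And>l. 1 \<le> l \<Longrightarrow> expectation (\<lambda>\<omega>. V l \<omega> ^ 4) \<le> C"
  shows "AE \<omega> in M. avg (\<lambda>l. V l \<omega>) \<longlonglongrightarrow> 0"
proof -
  define A where "A t \<omega> = avg (\<lambda>l. V l \<omega>) t" for t \<omega>
  have Am: "all_moments M (A t)" for t
    unfolding A_def avg_def using V by (intro all_moments_mult all_moments_sum all_moments_const) auto
  have bound: "expectation (\<lambda>\<omega>. A t \<omega> ^ 4) \<le> 3 * C\<^sup>2 * inverse (real t ^ 2)" for t
  \<comment> \<open>For \<open>t = 0\<close> both sides are 0 by the convention for division by
    zero.\<close>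
  proof (cases "t = 0")
    case False
    have "expectation (\<lambda>\<omega>. A t \<omega> ^ 4) = expectation (\<lambda>\<omega>. (\<Sum>l=1..t. V l \<omega>) ^ 4) / real t ^ 4"
      by (simp add: A_def avg_def power_mult_distrib power_divide)
    also have "\<dots> \<le> 3 * (real t)\<^sup>2 * C\<^sup>2 / real t ^ 4"
      using indep_vars_centered_sum_moments[OF assms] by (intro divide_right_mono) auto
    also have "\<dots> = 3 * C\<^sup>2 * inverse (real t ^ 2)" using False by (simp add: field_simps power4_eq_xxxx power2_eq_square)
    finally show ?thesis .
  qed (simp add: A_def avg_def)
  have summ: "summable (\<lambda>t. 3 * C\<^sup>2 * inverse (real t ^ 2))"
    by (intro summable_mult inverse_power_summable) simp
  have "(\<integral>\<^sup>+\<omega>. (\<Sum>t. ennreal (A t \<omega> ^ 4)) \<partial>M) = (\<Sum>t. \<integral>\<^sup>+\<omega>. ennreal (A t \<omega> ^ 4) \<partial>M)"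
    using all_moments_measurable[OF Am] by (intro nn_integral_suminf) simp
  also have "\<dots> = (\<Sum>t. ennreal (expectation (\<lambda>\<omega>. A t \<omega> ^ 4)))"
    using Am by (subst nn_integral_eq_integral) (auto intro: all_moments_power_integrable)
  also have "\<dots> \<le> (\<Sum>t. ennreal (3 * C\<^sup>2 * inverse (real t ^ 2)))"
    by (intro suminf_le ennreal_leI bound) auto
  also have "\<dots> = ennreal (\<Sum>t. 3 * C\<^sup>2 * inverse (real t ^ 2))"
    by (intro suminf_ennreal2 summ) simp
  also have "\<dots> < \<infinity>" by simp
  finally have fin: "(\<integral>\<^sup>+\<omega>. (\<Sum>t. ennreal (A t \<omega> ^ 4)) \<partial>M) \<noteq> \<infinity>" by simp
  have "AE \<omega> in M. (\<Sum>t. ennreal (A t \<omega> ^ 4)) \<noteq> \<infinity>"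
    using all_moments_measurable[OF Am] by (intro nn_integral_PInf_AE[OF _ fin]) simp
  then show ?thesis
  proof eventually_elim
    case (elim \<omega>)
    then have "summable (\<lambda>t. A t \<omega> ^ 4)"
      by (intro summable_suminf_not_top) auto
    then have "(\<lambda>t. root 4 (A t \<omega> ^ 4)) \<longlonglongrightarrow> root 4 0"
      by (intro tendsto_real_root summable_LIMSEQ_zero)
    moreover have "root 4 (z ^ 4) = \<bar>z\<bar>" for z :: real
      using real_root_power_cancel[of 4 "\<bar>z\<bar>"] by (simp add: power_even_abs)
    ultimately have "(\<lambda>t. \<bar>A t \<omega>\<bar>) \<longlonglongrightarrow> 0" by simp
    then have "(\<lambda>t. A t \<omega>) \<longlonglongrightarrow> 0" by (simp add: tendsto_rabs_zero_iff)
    then show ?case by (simp add: A_def)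
  qed
qed

end


section \<open>From the strong law to sample averages\<close>

lemma measurable_joint:
  assumes "\<forall>i\<in>{1..n}. X i \<in> borel_measurable P" "Y \<in> borel_measurable P"
  shows "joint n X Y \<in> measurable P (joint_space n)"
  unfolding joint_def joint_space_def using assms by (intro measurable_Pair measurable_restrict) auto

text \<open>The samples live on \<open>M\<close>, the population on \<open>P\<close>. Equality of
  the joint distributions carries integrability and moments of any measurable function of the data
  from one space to the other, after which the strong law is applied to the centred values.\<close>

lemma iid_samples_averages:
  assumes "prob_space P" "prob_space M"
    and X: "\<forall>i\<in>{1..n}. X i \<in> borel_measurable P" and Y: "Y \<in> borel_measurable P"
    and iid: "iid_samples n P X Y M Xs Ys"
    and \<phi>: "\<phi> \<in> borel_measurable (joint_space n)" and mom: "all_moments P (\<lambda>\<omega>. \<phi> (joint n X Y \<omega>))"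
  shows "AE \<omega> in M. avg (\<lambda>l. \<phi> (joint n (Xs l) (Ys l) \<omega>)) \<longlonglongrightarrow> (\<integral>\<omega>. \<phi> (joint n X Y \<omega>) \<partial>P)"
proof -
  interpret P: prob_space P by fact
  interpret M: prob_space M by fact
  define \<mu> where "\<mu> = (\<integral>\<omega>. \<phi> (joint n X Y \<omega>) \<partial>P)"
  define \<psi> where "\<psi> z = \<phi> z - \<mu>" for z
  define V where "V = (\<lambda>l \<omega>. \<psi> (joint n (Xs l) (Ys l) \<omega>))"
  note J = measurable_joint[OF X Y]
  have indep: "M.indep_vars (\<lambda>_. joint_space n) (\<lambda>l. joint n (Xs l) (Ys l)) {1..}"
    and distr: "\<And>l. 1 \<le> l \<Longrightarrow> distr M (joint_space n) (joint n (Xs l) (Ys l)) = distr P (joint_space n) (joint n X Y)"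
    using iid by (auto simp: iid_samples_def)
  have Jl: "joint n (Xs l) (Ys l) \<in> measurable M (joint_space n)" if "1 \<le> l" for l
    using indep that by (auto simp: M.indep_vars_def)
  have \<psi>: "\<psi> \<in> borel_measurable (joint_space n)" unfolding \<psi>_def using \<phi> by simp
  have same_int: "integrable M (\<lambda>\<omega>. g (joint n (Xs l) (Ys l) \<omega>)) \<longleftrightarrow> integrable P (\<lambda>\<omega>. g (joint n X Y \<omega>))"
    and same: "(\<integral>\<omega>. g (joint n (Xs l) (Ys l) \<omega>) \<partial>M) = (\<integral>\<omega>. g (joint n X Y \<omega>) \<partial>P)"
    if "1 \<le> l" "g \<in> borel_measurable (joint_space n)" for l and g :: "_ \<Rightarrow> real"
    using integrable_distr_eq[OF Jl[OF that(1)] that(2)] integrable_distr_eq[OF J that(2)]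
      integral_distr[OF Jl[OF that(1)] that(2)] integral_distr[OF J that(2)] distr[OF that(1)] by auto
  have mom_\<psi>: "all_moments P (\<lambda>\<omega>. \<psi> (joint n X Y \<omega>))"
    using all_moments_add[OF mom P.all_moments_const[of "- \<mu>"]] by (simp add: \<psi>_def)
  have pow: "(\<lambda>z. \<psi> z ^ k) \<in> borel_measurable (joint_space n)" for k using \<psi> by simp
  have momV: "all_moments M (V l)" if l: "1 \<le> l" for l
    using same_int[OF l pow] mom_\<psi> measurable_compose[OF Jl[OF l] \<psi>]
    by (auto simp: all_moments_def V_def)
  have indepV: "M.indep_vars (\<lambda>_. borel) V {1..}"
    unfolding V_def by (rule M.indep_vars_compose2[OF indep]) (use \<psi> in simp)
  have meanV: "M.expectation (V l) = 0" if l: "1 \<le> l" for l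
    using same[OF l \<psi>] all_moments_integrable[OF mom] by (simp add: V_def \<psi>_def \<mu>_def P.prob_space)
  define m where "m k = (\<integral>\<omega>. \<psi> (joint n X Y \<omega>) ^ k \<partial>P)" for k :: nat
  define C where "C = 1 + \<bar>m 2\<bar> + \<bar>m 4\<bar>"
  have powV: "M.expectation (\<lambda>\<omega>. V l \<omega> ^ k) = m k" if "1 \<le> l" for l k
    using same[OF that pow] by (simp add: V_def m_def)
  have "AE \<omega> in M. avg (\<lambda>l. V l \<omega>) \<longlonglongrightarrow> 0"
    by (rule M.AE_averages_tendsto_0[OF indepV momV meanV, of C]) (auto simp: powV C_def)
  then show ?thesis
  proof eventually_elim
    case (elim \<omega>)
    then have "(\<lambda>t. avg (\<lambda>l. V l \<omega>) t + \<mu>) \<longlonglongrightarrow> 0 + \<mu>" by (intro tendsto_add tendsto_const)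
    \<comment> \<open>At \<open>t = 0\<close> the two sides are \<open>\<mu>\<close> and 0, so the
      identity is claimed only from \<open>t = 1\<close> on.\<close>
    moreover have "\<forall>\<^sub>F t in sequentially. avg (\<lambda>l. V l \<omega>) t + \<mu> = avg (\<lambda>l. \<phi> (joint n (Xs l) (Ys l) \<omega>)) t"
      using eventually_gt_at_top[of 0]
      by eventually_elim (simp add: V_def \<psi>_def avg_def sum_subtractf right_diff_distrib diff_divide_distrib)
    ultimately have "avg (\<lambda>l. \<phi> (joint n (Xs l) (Ys l) \<omega>)) \<longlonglongrightarrow> 0 + \<mu>" by (rule Lim_transform_eventually)
    then show ?case by (simp add: \<mu>_def)
  qed
qed

section \<open>Coordinates of the feature vector and moments of the linear model\<close>

lemma feat_Suc: "finite S \<Longrightarrow> k < card S \<Longrightarrow> feat S x $ Suc k = x (sorted_list_of_set S ! k)"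
  unfolding feat_def vec_of_list_index by simp

text \<open>A case distinction that hides the sorted list of indices: a coordinate is either the
  constant 1 or one raw output.\<close>

lemma feat_coordinate:
  assumes "finite S" "i < card S + 1"
  obtains "\<And>x. feat S x $ i = 1" | j where "j \<in> S" "\<And>x. feat S x $ i = x j"
proof (cases i)
  case 0
  then show ?thesis using that(1) by (simp add: feat_0)
next
  case (Suc k)
  then have "k < length (sorted_list_of_set S)" using assms by simp
  from nth_mem[OF this] show ?thesis
    using assms Suc by (intro that(2)[of "sorted_list_of_set S ! k"]) (auto simp: feat_Suc)
qed

lemma feat_cong: "finite S \<Longrightarrow> (\<And>j. j \<in> S \<Longrightarrow> x j = x' j) \<Longrightarrow> feat S x = feat S x'"
  unfolding feat_def by (metis map_cong set_sorted_list_of_set)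

lemma models_finite: "S \<in> models n \<Longrightarrow> finite S"
  by (auto simp: models_def intro: finite_subset)

text \<open>Independence is given for the sigma-algebra of the whole vector. The sigma-algebra of a
  single coordinate is contained in it, so the expectation factors and the centred noise contributes
  0.\<close>

lemma indep_noise_integral_0:
  assumes "prob_space P" and e: "all_moments P e" and e0: "prob_space.expectation P e = 0"
    and Z: "all_moments P (X j)" and j: "j \<in> S"
    and indep: "prob_space.indep_set P (sets (vimage_algebra (space P) e borel))
            (sets (vimage_algebra (space P) (\<lambda>\<omega>. \<lambda>i\<in>S. X i \<omega>) (PiM S (\<lambda>_. borel))))"
  shows "(\<integral>\<omega>. X j \<omega> * e \<omega> \<partial>P) = 0"
proof -
  interpret prob_space P by fact
  let ?R = "\<lambda>\<omega>. \<lambda>i\<in>S. X i \<omega>"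
  let ?A = "vimage_algebra (space P) ?R (PiM S (\<lambda>_. borel))"
  have "?R \<in> measurable ?A (PiM S (\<lambda>_. borel))"
    by (rule measurable_vimage_algebra1) (auto simp: space_PiM)
  then have "(\<lambda>\<omega>. ?R \<omega> j) \<in> borel_measurable ?A"
    using j by (rule measurable_compose[OF _ measurable_component_singleton])
  then have "X j \<in> borel_measurable ?A" using j by simp
  then have "{X j -` A \<inter> space P | A. A \<in> sets borel} \<subseteq> sets ?A"
    by (auto dest: measurable_sets)
  from sets.sigma_sets_subset[OF this]
  have sub: "sigma_sets (space P) {X j -` A \<inter> space P | A. A \<in> sets borel} \<subseteq> sets ?A" by simp
  have "indep_set (sigma_sets (space P) {e -` A \<inter> space P | A. A \<in> sets borel})
     (sigma_sets (space P) {X j -` A \<inter> space P | A. A \<in> sets borel})"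
    unfolding indep_set_def
    by (rule indep_sets_mono_sets[OF indep[unfolded indep_set_def]])
      (use sub in \<open>auto simp: sets_vimage_algebra split: bool.split\<close>)
  then have "indep_var borel e borel (X j)"
    using e Z by (auto simp: indep_var_eq all_moments_measurable)
  from indep_var_lebesgue_integral[OF this all_moments_integrable[OF e] all_moments_integrable[OF Z]]
  show ?thesis using e0 by (simp add: mult.commute)
qed

lemma XS_index_le_vnorm: "i < card S + 1 \<Longrightarrow> \<bar>XS X S \<omega> $ i\<bar> \<le> vnorm (XS X S \<omega>)"
proof -
  assume i: "i < card S + 1"
  have "(XS X S \<omega> $ i)\<^sup>2 \<le> (\<Sum>j<card S + 1. (XS X S \<omega> $ j)\<^sup>2)"
    using i by (intro member_le_sum) auto
  also have "\<dots> = XS X S \<omega> \<bullet> XS X S \<omega>"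
    unfolding scalar_prod_def XS_def dim_feat by (simp add: power2_eq_square atLeast0LessThan)
  finally show ?thesis unfolding vnorm_def by (rule real_le_rsqrt[of "\<bar>_\<bar>", unfolded power2_abs])
qed

lemma measurable_XS:
  assumes "\<forall>i\<in>{1..n}. X i \<in> borel_measurable P" "S \<in> models n" "i < card S + 1"
  shows "(\<lambda>\<omega>. XS X S \<omega> $ i) \<in> borel_measurable P"
proof (cases rule: feat_coordinate[OF models_finite[OF assms(2)] assms(3)])
  case (2 j)
  then show ?thesis using assms by (auto simp: XS_def models_def)
qed (simp add: XS_def)

text \<open>Each coordinate is dominated by the Euclidean norm, whose Orlicz norm is finite by
  \<open>moment_bound\<close>.\<close>

lemma all_moments_XS:
  assumes X: "\<forall>i\<in>{1..n}. X i \<in> borel_measurable P" and S: "S \<in> models n"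
    and mb: "moment_bound P X S K" and i: "i < card S + 1"
  shows "all_moments P (\<lambda>\<omega>. XS X S \<omega> $ i)"
proof (rule all_moments_bound)
  have "vnorm (XS X S \<omega>) = sqrt (\<Sum>j<card S + 1. XS X S \<omega> $ j * XS X S \<omega> $ j)" for \<omega>
    unfolding vnorm_def scalar_prod_def XS_def dim_feat by (simp add: atLeast0LessThan)
  then have "(\<lambda>\<omega>. vnorm (XS X S \<omega>)) \<in> borel_measurable P"
    using measurable_XS[OF X S] by (simp del: sum.lessThan_Suc add: borel_measurable_sum borel_measurable_times)
  moreover have "psi_norm P 1 (\<lambda>\<omega>. vnorm (XS X S \<omega>)) < \<infinity>"
    using mb unfolding moment_bound_def by (auto intro: le_less_trans)
  ultimately show "all_moments P (\<lambda>\<omega>. vnorm (XS X S \<omega>))" by (intro all_moments_if_psi_norm_finite[of _ P 1]) auto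
qed (use measurable_XS[OF X S i] XS_index_le_vnorm[OF i] in auto)

text \<open>The noise is orthogonal to every coordinate of the feature vector: to the constant one
  because it is centred, to the others by independence. This yields the population normal equations
  and the second moment of \<open>Y\<close>.\<close>

lemma linear_model_moments:
  assumes "prob_space P" and X: "\<forall>i\<in>{1..n}. X i \<in> borel_measurable P" and Y: "Y \<in> borel_measurable P"
    and S: "S \<in> models n" and lm: "linear_model P X Y S b v" and mb: "moment_bound P X S K"
  shows "all_moments P Y"
    and "\<And>i. i < card S + 1 \<Longrightarrow> (\<integral>\<omega>. XS X S \<omega> $ i * Y \<omega> \<partial>P) = (moment_mat P X S *\<^sub>v b) $ i"
    and "(\<integral>\<omega>. Y \<omega> * Y \<omega> \<partial>P) = v + b \<bullet> (moment_mat P X S *\<^sub>v b)"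
proof -
  interpret prob_space P by fact
  define d where "d = card S + 1"
  let ?x = "\<lambda>i \<omega>. XS X S \<omega> $ i" and ?L = "moment_mat P X S"
  obtain e where b: "b \<in> carrier_vec d" and em: "e \<in> borel_measurable P"
    and Ye: "AE \<omega> in P. Y \<omega> = XS X S \<omega> \<bullet> b + e \<omega>" and psi: "psi_norm P 2 e < \<infinity>"
    and e0: "expectation e = 0" and ev: "variance e = v"
    and indep: "indep_set (sets (vimage_algebra (space P) e borel))
            (sets (vimage_algebra (space P) (\<lambda>\<omega>. \<lambda>i\<in>S. X i \<omega>) (PiM S (\<lambda>_. borel))))"
    using lm unfolding linear_model_def d_def by blast
  have e: "all_moments P e" by (rule all_moments_if_psi_norm_finite[OF em _ psi]) simp
  have x: "all_moments P (?x i)" if "i < d" for i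
    using all_moments_XS[OF X S mb] that by (simp add: d_def)
  have "XS X S \<omega> \<bullet> b = (\<Sum>j<d. b $ j * ?x j \<omega>)" for \<omega>
    unfolding scalar_prod_def carrier_vecD[OF b] by (simp add: atLeast0LessThan mult.commute)
  then have Ye: "AE \<omega> in P. Y \<omega> = (\<Sum>j<d. b $ j * ?x j \<omega>) + e \<omega>" using Ye by simp
  have "all_moments P (\<lambda>\<omega>. (\<Sum>j<d. b $ j * ?x j \<omega>) + e \<omega>)"
    using e x by (intro all_moments_add all_moments_sum all_moments_mult all_moments_const) auto
  then show Ymom: "all_moments P Y" by (rule all_moments_cong_AE[OF _ Y]) (use Ye in auto)
  have xe: "(\<integral>\<omega>. ?x i \<omega> * e \<omega> \<partial>P) = 0" if i: "i < d" for i
  proof (cases rule: feat_coordinate[OF models_finite[OF S] i[unfolded d_def]])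
    case 1
    then show ?thesis using e0 by (simp add: XS_def)
  next
    case (2 j)
    then have "?x i = X j" by (auto simp: XS_def)
    then show ?thesis
      using indep_noise_integral_0[OF \<open>prob_space P\<close> e e0 _ 2(1) indep] x[OF i] by (simp add: fun_eq_iff)
  qed
  \<comment> \<open>Inserting the linear model for \<open>Y\<close> against a test variable;
    \<open>g\<close> will be a coordinate, then the noise, then \<open>Y\<close> itself.\<close>
  have expand: "(\<integral>\<omega>. g \<omega> * Y \<omega> \<partial>P) = (\<Sum>j<d. b $ j * (\<integral>\<omega>. ?x j \<omega> * g \<omega> \<partial>P)) + (\<integral>\<omega>. g \<omega> * e \<omega> \<partial>P)"
    if g: "all_moments P g" for g
  proof -
    have "(\<integral>\<omega>. g \<omega> * Y \<omega> \<partial>P) = (\<integral>\<omega>. (\<Sum>j<d. b $ j * (?x j \<omega> * g \<omega>)) + g \<omega> * e \<omega> \<partial>P)"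
    proof (rule integral_cong_AE)
      show "AE \<omega> in P. g \<omega> * Y \<omega> = (\<Sum>j<d. b $ j * (?x j \<omega> * g \<omega>)) + g \<omega> * e \<omega>"
        using Ye by eventually_elim (simp add: distrib_left sum_distrib_left mult_ac)
    qed (use g e x Ymom in \<open>auto intro!: all_moments_measurable all_moments_add all_moments_sum all_moments_mult all_moments_const\<close>)
    also have "\<dots> = (\<integral>\<omega>. (\<Sum>j<d. b $ j * (?x j \<omega> * g \<omega>)) \<partial>P) + (\<integral>\<omega>. g \<omega> * e \<omega> \<partial>P)"
      using g e x
      by (intro Bochner_Integration.integral_add Bochner_Integration.integrable_sum integrable_mult_right
          all_moments_integrable all_moments_mult) auto
    also have "(\<integral>\<omega>. (\<Sum>j<d. b $ j * (?x j \<omega> * g \<omega>)) \<partial>P) = (\<Sum>j<d. (\<integral>\<omega>. b $ j * (?x j \<omega> * g \<omega>) \<partial>P))"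
      using g x by (intro Bochner_Integration.integral_sum integrable_mult_right all_moments_integrable all_moments_mult) auto
    finally show ?thesis by simp
  qed
  have Lc: "?L \<in> carrier_mat d d" by (simp add: moment_mat_def d_def)
  have L: "?L $$ (i, j) = (\<integral>\<omega>. ?x i \<omega> * ?x j \<omega> \<partial>P)" if "i < d" "j < d" for i j
    using that by (simp add: moment_mat_def d_def)
  have xY: "(\<integral>\<omega>. ?x i \<omega> * Y \<omega> \<partial>P) = (?L *\<^sub>v b) $ i" if i: "i < d" for i
    unfolding expand[OF x[OF i]] xe[OF i] index_mult_mat_vec_sum[OF b Lc i]
    using i by (auto simp: L mult_ac intro!: sum.cong)
  then show "(\<integral>\<omega>. ?x i \<omega> * Y \<omega> \<partial>P) = (?L *\<^sub>v b) $ i" if "i < card S + 1" for i using that by (simp add: d_def)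
  have "(\<integral>\<omega>. e \<omega> * Y \<omega> \<partial>P) = (\<integral>\<omega>. e \<omega> * e \<omega> \<partial>P)" unfolding expand[OF e] by (simp add: xe)
  also have "\<dots> = v" using ev e0 by (simp add: power2_eq_square)
  finally have eY: "(\<integral>\<omega>. Y \<omega> * e \<omega> \<partial>P) = v" by (simp add: mult.commute)
  have "(\<integral>\<omega>. Y \<omega> * Y \<omega> \<partial>P) = (\<Sum>j<d. b $ j * (?L *\<^sub>v b) $ j) + v"
    unfolding expand[OF Ymom] eY by (simp add: xY)
  also have "(\<Sum>j<d. b $ j * (?L *\<^sub>v b) $ j) = b \<bullet> (?L *\<^sub>v b)"
    unfolding scalar_prod_def using carrier_matD[OF Lc] by (simp add: atLeast0LessThan)
  finally show "(\<integral>\<omega>. Y \<omega> * Y \<omega> \<partial>P) = v + b \<bullet> (?L *\<^sub>v b)" by simp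
qed

section \<open>Population quantities and sample moments\<close>

text \<open>The strong law for finitely many functions of a joint sample, so that the exceptional
  null sets can be united. \<open>linear_model_moments\<close> identifies the limits involving
  \<open>Y\<close>.\<close>

lemma sample_moments_converge:
  assumes "prob_space P" "prob_space M"
    and X: "\<forall>i\<in>{1..n}. X i \<in> borel_measurable P" and Y: "Y \<in> borel_measurable P"
    and iid: "iid_samples n P X Y M Xs Ys"
    and S: "S \<in> models n" and lm: "linear_model P X Y S b v" and mb: "moment_bound P X S K"
  defines "d \<equiv> card S + 1" and "x \<equiv> \<lambda>\<omega> l i. feat S (\<lambda>i. Xs l i \<omega>) $ i"
  shows "AE \<omega> in M.
    (\<forall>i\<in>{..<d}. \<forall>j\<in>{..<d}. avg (\<lambda>l. x \<omega> l i * x \<omega> l j) \<longlonglongrightarrow> moment_mat P X S $$ (i, j)) \<and>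
    (\<forall>i\<in>{..<d}. avg (\<lambda>l. x \<omega> l i * Ys l \<omega>) \<longlonglongrightarrow> (moment_mat P X S *\<^sub>v b) $ i) \<and>
    avg (\<lambda>l. Ys l \<omega> * Ys l \<omega>) \<longlonglongrightarrow> v + b \<bullet> (moment_mat P X S *\<^sub>v b)"
proof -
  note mom = linear_model_moments[OF \<open>prob_space P\<close> X Y S lm mb]
  have xm: "all_moments P (\<lambda>\<omega>. XS X S \<omega> $ i)" if "i < d" for i
    using all_moments_XS[OF X S mb] that by (simp add: d_def)
  have sub: "S \<subseteq> {1..n}" using S by (simp add: models_def)
  \<comment> \<open>Polymorphic in the sample space \<open>'z\<close>, since it is applied to the
    population and to the samples. The restriction to \<open>{1..n}\<close> inside
    \<open>joint\<close> is invisible because \<open>S \<subseteq> {1..n}\<close>.\<close>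
  have feat_joint: "feat S (fst (joint n X' Y' \<omega>)) = feat S (\<lambda>i. X' i \<omega>)"
    for X' Y' and \<omega> :: 'z
    using sub by (intro feat_cong models_finite[OF S]) (auto simp: joint_def)
  have snd_joint: "snd (joint n X' Y' \<omega>) = Y' \<omega>" for X' Y' and \<omega> :: 'z by (simp add: joint_def)
  have fm: "(\<lambda>z. feat S (fst z) $ i) \<in> borel_measurable (joint_space n)" if i: "i < d" for i
  proof (cases rule: feat_coordinate[OF models_finite[OF S] i[unfolded d_def]])
    case (2 j)
    then have "(\<lambda>z. fst z j) \<in> borel_measurable (joint_space n)"
      unfolding joint_space_def using sub
      by (intro measurable_compose[OF measurable_fst measurable_component_singleton]) auto
    then show ?thesis using 2 by simp
  qed simp
  have sm: "snd \<in> borel_measurable (joint_space n)" by (simp add: joint_space_def)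
  note slln = iid_samples_averages[OF assms(1-5)]
  have xx: "AE \<omega> in M. avg (\<lambda>l. x \<omega> l i * x \<omega> l j) \<longlonglongrightarrow> moment_mat P X S $$ (i, j)" if "i < d" "j < d" for i j
    using slln[of "\<lambda>z. feat S (fst z) $ i * feat S (fst z) $ j"] all_moments_mult[OF xm xm, OF that] fm that
    by (simp add: feat_joint x_def XS_def moment_mat_def d_def)
  have xy: "AE \<omega> in M. avg (\<lambda>l. x \<omega> l i * Ys l \<omega>) \<longlonglongrightarrow> (moment_mat P X S *\<^sub>v b) $ i" if "i < d" for i
    using slln[of "\<lambda>z. feat S (fst z) $ i * snd z"] all_moments_mult[OF xm[OF that] mom(1)] fm[OF that] sm mom(2)[of i] that
    by (simp add: feat_joint snd_joint x_def XS_def d_def)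
  have yy: "AE \<omega> in M. avg (\<lambda>l. Ys l \<omega> * Ys l \<omega>) \<longlonglongrightarrow> v + b \<bullet> (moment_mat P X S *\<^sub>v b)"
    using slln[of "\<lambda>z. snd z * snd z"] all_moments_mult[OF mom(1) mom(1)] sm mom(3)
    by (simp add: snd_joint)
  show ?thesis
    by (intro AE_conjI AE_finite_allI xx xy yy) auto
qed

text \<open>As coordinate 0 is constantly 1, the moment matrix already contains the means, in its
  first column, and therefore the covariances.\<close>

lemma
  assumes "prob_space P" and X: "\<forall>i\<in>{1..n}. X i \<in> borel_measurable P"
    and S: "S \<in> models n" and mb: "moment_bound P X S K"
  shows mean_vec_index: "\<And>i. i < card S + 1 \<Longrightarrow> mean_vec P X S $ i = moment_mat P X S $$ (i, 0)"
    and mean_vec_0: "mean_vec P X S $ 0 = 1"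
    and cov_mat_index: "\<And>i j. i < card S + 1 \<Longrightarrow> j < card S + 1 \<Longrightarrow>
      cov_mat P X S $$ (i, j) = moment_mat P X S $$ (i, j) - moment_mat P X S $$ (i, 0) * moment_mat P X S $$ (j, 0)"
proof -
  interpret prob_space P by fact
  have x0: "XS X S \<omega> $ 0 = 1" for \<omega> by (simp add: XS_def feat_0)
  show mean: "mean_vec P X S $ i = moment_mat P X S $$ (i, 0)" if "i < card S + 1" for i
    using that by (simp add: mean_vec_def moment_mat_def x0)
  show "mean_vec P X S $ 0 = 1" by (simp add: mean_vec_def x0 prob_space)
  fix i j assume ij: "i < card S + 1" "j < card S + 1"
  let ?x = "\<lambda>i \<omega>. XS X S \<omega> $ i" and ?m = "\<lambda>i. mean_vec P X S $ i"
  have x: "all_moments P (?x i)" "all_moments P (?x j)" using all_moments_XS[OF X S mb] ij by auto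
  have int: "integrable P (?x i)" "integrable P (?x j)" "integrable P (\<lambda>\<omega>. ?x i \<omega> * ?x j \<omega>)"
    using x by (auto intro: all_moments_integrable all_moments_mult)
  have m: "expectation (?x i) = ?m i" "expectation (?x j) = ?m j" using ij by (auto simp: mean_vec_def)
  have "cov_mat P X S $$ (i, j) = expectation (\<lambda>\<omega>. ?x i \<omega> * ?x j \<omega> - ?m j * ?x i \<omega> - ?m i * ?x j \<omega> + ?m i * ?m j)"
    using ij by (simp add: cov_mat_def algebra_simps)
  also have "\<dots> = expectation (\<lambda>\<omega>. ?x i \<omega> * ?x j \<omega>) - ?m i * ?m j"
    using int m by (simp add: prob_space)
  finally show "cov_mat P X S $$ (i, j) = moment_mat P X S $$ (i, j) - moment_mat P X S $$ (i, 0) * moment_mat P X S $$ (j, 0)"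
    using ij by (simp add: mean moment_mat_def)
qed

lemma k2_eq:
  assumes "prob_space P" "\<forall>i\<in>{1..n}. X i \<in> borel_measurable P"
    and "S \<in> models n" "moment_bound P X S K" and inv: "invertible_mat (moment_mat P X S)"
  shows "k2 P X \<sigma>2 S = \<sigma>2 S"
proof -
  have L: "moment_mat P X S \<in> carrier_mat (card S + 1) (card S + 1)" by (simp add: moment_mat_def)
  have "mat_trace (outer (mean_vec P X S) (mean_vec P X S) * inv_mat (moment_mat P X S)) = 1"
    using mean_vec_index[OF assms(1-4)] mean_vec_0[OF assms(1-4)]
    by (intro trace_outer_inv_mat[OF L invertible_mat_det_nonzero[OF L inv]]) (auto simp: mean_vec_def)
  then show ?thesis by (simp add: k2_def)
qed

lemma quad_cov_mat:
  assumes "prob_space P" "\<forall>i\<in>{1..n}. X i \<in> borel_measurable P"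
    and "S \<in> models n" "moment_bound P X S K" and b: "b \<in> carrier_vec (card S + 1)"
  shows "b \<bullet> (cov_mat P X S *\<^sub>v b) = (\<Sum>i<card S + 1. \<Sum>j<card S + 1. b $ i * b $ j *
    (moment_mat P X S $$ (i, j) - moment_mat P X S $$ (i, 0) * moment_mat P X S $$ (j, 0)))"
proof -
  have "cov_mat P X S \<in> carrier_mat (card S + 1) (card S + 1)" by (simp add: cov_mat_def)
  from scalar_prod_mult_mat_vec[OF b this] show ?thesis
    by (simp add: cov_mat_index[OF assms(1-4)] del: sum.lessThan_Suc)
qed

text \<open>The variance of \<open>Y\<close> splits into explained part and noise variance. Its
  value does not depend on the model, so two models with vanishing explained part have the same
  noise variance; this settles the degenerate case.\<close>

lemma explained_variance:
  assumes "prob_space P" and X: "\<forall>i\<in>{1..n}. X i \<in> borel_measurable P" and Y: "Y \<in> borel_measurable P"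
    and S: "S \<in> models n" and lm: "linear_model P X Y S b v" and mb: "moment_bound P X S K"
  shows "b \<bullet> (cov_mat P X S *\<^sub>v b) = (\<integral>\<omega>. Y \<omega> * Y \<omega> \<partial>P) - (\<integral>\<omega>. Y \<omega> \<partial>P)\<^sup>2 - v"
proof -
  define d where "d = card S + 1"
  let ?L = "moment_mat P X S"
  note mom = linear_model_moments[OF assms]
  have b: "b \<in> carrier_vec d" using lm by (simp add: linear_model_def d_def)
  have L: "?L \<in> carrier_mat d d" by (simp add: moment_mat_def d_def)
  have d0: "0 < d" by (simp add: d_def)
  have sym: "?L $$ (0, j) = ?L $$ (j, 0)" if "j < d" for j
    using that by (simp add: moment_mat_def d_def mult.commute)
  have "(\<integral>\<omega>. Y \<omega> \<partial>P) = (?L *\<^sub>v b) $ 0"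
    using mom(2)[of 0] by (simp add: XS_def feat_0)
  also have "\<dots> = (\<Sum>j<d. b $ j * ?L $$ (j, 0))"
    unfolding index_mult_mat_vec_sum[OF b L d0] by (rule sum.cong) (auto simp: sym)
  finally have EY: "(\<integral>\<omega>. Y \<omega> \<partial>P) = (\<Sum>j<d. b $ j * ?L $$ (j, 0))" .
  have "b \<bullet> (cov_mat P X S *\<^sub>v b) = (\<Sum>i<d. \<Sum>j<d. b $ i * b $ j * (?L $$ (i, j) - ?L $$ (i, 0) * ?L $$ (j, 0)))"
    using quad_cov_mat[OF assms(1) X S mb] b by (simp add: d_def)
  also have "\<dots> = (\<Sum>i<d. \<Sum>j<d. b $ i * b $ j * ?L $$ (i, j)) - (\<Sum>i<d. \<Sum>j<d. (b $ i * ?L $$ (i, 0)) * (b $ j * ?L $$ (j, 0)))"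
    by (simp add: right_diff_distrib sum_subtractf mult_ac)
  also have "(\<Sum>i<d. \<Sum>j<d. b $ i * b $ j * ?L $$ (i, j)) = b \<bullet> (?L *\<^sub>v b)"
    by (rule scalar_prod_mult_mat_vec[OF b L, symmetric])
  also have "(\<Sum>i<d. \<Sum>j<d. (b $ i * ?L $$ (i, 0)) * (b $ j * ?L $$ (j, 0))) = (\<integral>\<omega>. Y \<omega> \<partial>P)\<^sup>2"
    unfolding EY power2_eq_square sum_product ..
  finally show ?thesis using mom(3) by simp
qed

section \<open>The algorithm along a consistent path\<close>

lemma exploration_objective_at_optimum:
  fixes a b ce B :: real
  assumes "0 \<le> a" "0 < b" "0 < ce" "0 < B" and m: "m = opt_rounds ce B a b"
  shows "a / (B - ce * m) + b / m = (sqrt a + sqrt (ce * b))\<^sup>2 / B"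
proof -
  \<comment> \<open>With this substitution \<open>a = b * q^2 / ce\<close> and both sides become
    rational in \<open>q\<close>, apart from the common root of \<open>b / ce\<close>.\<close>
  define q where "q = sqrt (ce * a / b)"
  have q: "0 \<le> q" "q\<^sup>2 = ce * a / b" using assms by (auto simp: q_def)
  have a: "a = b * q\<^sup>2 / ce" using q assms by (simp add: field_simps)
  have "sqrt a = sqrt (q\<^sup>2 * (b / ce))" by (subst a) (simp add: mult.commute)
  then have "sqrt a = q * sqrt (b / ce)" using \<open>0 \<le> q\<close> by (simp only: real_sqrt_mult real_sqrt_abs abs_of_nonneg)
  moreover have "sqrt (ce * b) = ce * sqrt (b / ce)"
    using assms by (simp add: real_sqrt_mult real_sqrt_divide field_simps flip: power2_eq_square)
  ultimately have "(sqrt a + sqrt (ce * b))\<^sup>2 = (q + ce)\<^sup>2 * (sqrt (b / ce))\<^sup>2"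
    by (simp add: power_mult_distrib[symmetric] algebra_simps)
  then have rhs: "(sqrt a + sqrt (ce * b))\<^sup>2 = (q + ce)\<^sup>2 * (b / ce)" using assms by simp
  have m': "m = B / (ce + q)" by (simp add: m opt_rounds_def q_def)
  have cq: "ce + q > 0" using q assms by simp
  have d: "B - ce * m = B * q / (ce + q)" using cq by (simp add: m' field_simps)
  have "a / (B - ce * m) = b * q * (ce + q) / (ce * B)"
  \<comment> \<open>If \<open>q = 0\<close>, then \<open>a = 0\<close> and
    \<open>B - ce * m = 0\<close>; the convention for division by zero makes both sides 0.\<close>
  proof (cases "q = 0")
    case False
    then show ?thesis unfolding d a using assms cq by (simp add: field_simps power2_eq_square)
  qed (simp add: a)
  moreover have "b / m = b * (ce + q) / B" by (simp add: m')
  ultimately have "a / (B - ce * m) + b / m = b * q * (ce + q) / (ce * B) + b * (ce + q) / B" by simp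
  also have "\<dots> = (q + ce)\<^sup>2 * (b / ce) / B"
    using \<open>0 < ce\<close> \<open>0 < B\<close> by (simp add: field_simps power2_eq_square)
  finally show ?thesis unfolding rhs .
qed

text \<open>The Cauchy-Schwarz inequality in the form
  \<open>(s + u)^2 / (p + r) \<le> s^2 / p + u^2 / r\<close>; after multiplication by
  \<open>p + r\<close> the defect is an explicit square over \<open>p * r\<close>.\<close>

lemma exploration_objective_ge:
  fixes a b ce B m :: real
  assumes "0 \<le> a" "0 < b" "0 < ce" "0 < m" "ce * m < B"
  shows "(sqrt a + sqrt (ce * b))\<^sup>2 / B \<le> a / (B - ce * m) + b / m"
proof -
  define s u p r where "s = sqrt a" and "u = sqrt (ce * b)" and "p = B - ce * m" and "r = ce * m"
  have pos: "p > 0" "r > 0" and B: "B = p + r" using assms by (auto simp: p_def r_def)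
  have "(s\<^sup>2 / p + u\<^sup>2 / r) * (p + r) - (s + u)\<^sup>2 = (s * r - u * p)\<^sup>2 / (p * r)"
    using pos by (simp add: field_simps power2_eq_square)
  also have "\<dots> \<ge> 0" using pos by simp
  finally have "(s + u)\<^sup>2 / (p + r) \<le> s\<^sup>2 / p + u\<^sup>2 / r"
    using pos by (simp add: divide_le_eq)
  moreover have "s\<^sup>2 = a" "u\<^sup>2 / r = b / m" using assms by (auto simp: s_def u_def r_def)
  ultimately have "(s + u)\<^sup>2 / B \<le> a / p + b / m" by (simp only: B)
  then show ?thesis by (simp only: s_def u_def p_def)
qed

section \<open>The optimal number of rounds per unit of budget\<close>

lemma opt_rounds_scale: "opt_rounds ce B a b = B * opt_rounds ce 1 a b"
  by (simp add: opt_rounds_def)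

lemma opt_rounds_1_pos: "0 < opt_rounds ce 1 a b" if "0 < ce" "0 \<le> a" "0 < b"
  using that by (simp add: opt_rounds_def add_pos_nonneg)

lemma opt_rounds_1_le: "opt_rounds ce 1 a b \<le> 1 / ce" if "0 < ce" "0 \<le> a" "0 < b"
  using that by (simp add: opt_rounds_def frac_le)

lemma opt_rounds_1_less: "opt_rounds ce 1 a b < 1 / ce" if "0 < ce" "0 < a" "0 < b"
  using that by (simp add: opt_rounds_def frac_less2)

lemma tendsto_opt_rounds_1:
  assumes "(f \<longlongrightarrow> a) F" "(g \<longlongrightarrow> b) F" "0 < ce" "0 \<le> a" "0 < b"
  shows "((\<lambda>t. opt_rounds ce 1 (f t) (g t)) \<longlongrightarrow> opt_rounds ce 1 a b) F"
proof -
  have "ce + sqrt (ce * a / b) > 0" using assms by (simp add: add_pos_nonneg)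
  then show ?thesis unfolding opt_rounds_def by (intro tendsto_intros assms) (use assms in auto)
qed

lemma finite_models: "finite (models n)"
  by (rule finite_subset[of _ "Pow {1..n}"]) (auto simp: models_def)

text \<open>The deterministic facts about one sample path that the analysis of the algorithm uses;
  \<open>a\<close> and \<open>b\<close> play the roles of \<open>k1\<close> and \<open>k2\<close>.
  The assumption \<open>degenerate\<close> will be supplied by \<open>explained_variance\<close> and
  the uniqueness of the minimiser.\<close>

locale consistent_path =
  fixes n :: nat and c \<alpha> :: "nat \<Rightarrow> real" and tie :: "nat set set \<Rightarrow> nat set"
    and x :: "nat \<Rightarrow> nat \<Rightarrow> real" and y :: "nat \<Rightarrow> real"
    and a b :: "nat set \<Rightarrow> real" and Sopt :: "nat set"
  assumes ce_pos: "0 < c_epr n c"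
    and tie: "\<And>A. A \<noteq> {} \<Longrightarrow> A \<subseteq> models n \<Longrightarrow> tie A \<in> A"
    and k1_hat_nonneg: "\<And>t S. n + 2 \<le> t \<Longrightarrow> S \<in> models n \<Longrightarrow> 0 \<le> k1_hat c x y t S"
    and k2_hat_pos: "\<And>t S. n + 2 \<le> t \<Longrightarrow> S \<in> models n \<Longrightarrow> 0 < k2_hat \<alpha> x y t S"
    and k1_hat_lim: "\<And>S. S \<in> models n \<Longrightarrow> (\<lambda>t. k1_hat c x y t S) \<longlonglongrightarrow> a S"
    and k2_hat_lim: "\<And>S. S \<in> models n \<Longrightarrow> (\<lambda>t. k2_hat \<alpha> x y t S) \<longlonglongrightarrow> b S"
    and b_pos: "\<And>S. S \<in> models n \<Longrightarrow> 0 < b S"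
    and Sopt: "Sopt \<in> models n"
    and Sopt_less: "\<And>S. S \<in> models n \<Longrightarrow> S \<noteq> Sopt \<Longrightarrow>
      (sqrt (a Sopt) + sqrt (c_epr n c * b Sopt))\<^sup>2 < (sqrt (a S) + sqrt (c_epr n c * b S))\<^sup>2"
    and degenerate: "\<And>S. S \<in> models n \<Longrightarrow> S \<noteq> Sopt \<Longrightarrow> a Sopt = 0 \<Longrightarrow> 0 < a S"
begin

abbreviation "ce \<equiv> c_epr n c"
abbreviation "k1t \<equiv> k1_hat c x y"
abbreviation "k2t \<equiv> k2_hat \<alpha> x y"
abbreviation "ht \<equiv> h_hat n c \<alpha> x y"
abbreviation "sel \<equiv> S_hat n c \<alpha> tie x y"
text \<open>For the estimates at time \<open>t\<close>, \<open>rate t S\<close> is the minimiser of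
  the objective as a share of the budget and \<open>\<gamma> t S\<close> is \<open>B\<close> times
  the minimum. The number \<open>r\<close> is the oracle share for \<open>Sopt\<close>.\<close>

abbreviation "rate t S \<equiv> opt_rounds ce 1 (k1t t S) (k2t t S)"
abbreviation "\<gamma> t S \<equiv> (sqrt (k1t t S) + sqrt (ce * k2t t S))\<^sup>2"
abbreviation "r \<equiv> opt_rounds ce 1 (a Sopt) (b Sopt)"
abbreviation "rounds \<equiv> aetc_rounds n c \<alpha> tie x y"

lemma a_nonneg: "S \<in> models n \<Longrightarrow> 0 \<le> a S"
  by (rule LIMSEQ_le_const[OF k1_hat_lim]) (auto intro!: exI[of _ "n + 2"] k1_hat_nonneg)

lemma m_hat_eq: "m_hat n c \<alpha> x y B t S = B * rate t S"
  unfolding m_hat_def by (rule opt_rounds_scale)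

lemma rate_lim: "S \<in> models n \<Longrightarrow> (\<lambda>t. rate t S) \<longlonglongrightarrow> opt_rounds ce 1 (a S) (b S)"
  by (intro tendsto_opt_rounds_1 k1_hat_lim k2_hat_lim ce_pos a_nonneg b_pos)

lemma rate_pos: "n + 2 \<le> t \<Longrightarrow> S \<in> models n \<Longrightarrow> 0 < rate t S"
  by (intro opt_rounds_1_pos ce_pos k1_hat_nonneg k2_hat_pos)

lemma r_pos: "0 < r"
  by (intro opt_rounds_1_pos ce_pos a_nonneg b_pos Sopt)

lemma r_le: "r \<le> 1 / ce"
  by (intro opt_rounds_1_le ce_pos a_nonneg b_pos Sopt)

text \<open>As long as the optimal time is not passed, the maximum in \<open>h_hat\<close> is the
  minimiser itself.\<close>

lemma h_hat_before:
  assumes "n + 2 \<le> t" "S \<in> models n" "0 < B" "real t \<le> B * rate t S"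
  shows "ht B t S = \<gamma> t S / B"
  using exploration_objective_at_optimum[OF k1_hat_nonneg[OF assms(1,2)] k2_hat_pos[OF assms(1,2)] ce_pos \<open>0 < B\<close> refl]
    assms by (simp add: h_hat_def m_hat_eq Let_def max_absorb1 opt_rounds_scale[of _ B])

lemma h_hat_after:
  assumes "B * rate t S \<le> real t"
  shows "ht B t S = k1t t S / (B - ce * real t) + k2t t S / real t"
  using assms by (simp add: h_hat_def m_hat_eq Let_def max_absorb2)

lemma h_hat_ge:
  assumes "n + 2 \<le> t" "S \<in> models n" "ce * real t < B"
  shows "\<gamma> t S / B \<le> ht B t S"
proof -
  have "0 < ce * real t" using ce_pos assms by simp
  then have B: "0 < B" using assms by linarith
  show ?thesis
  proof (cases "real t \<le> B * rate t S")
    case True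
    then show ?thesis using h_hat_before[OF assms(1,2) B] by simp
  next
    case False
    then show ?thesis
      using exploration_objective_ge[OF k1_hat_nonneg[OF assms(1,2)] k2_hat_pos[OF assms(1,2)] ce_pos, of "real t" B] assms
      by (simp add: h_hat_after)
  qed
qed

text \<open>Strict pairwise comparison makes the set of minimisers a singleton, which leaves the tie
  rule no choice.\<close>

lemma S_hat_eqI:
  assumes "\<And>S. S \<in> models n \<Longrightarrow> S \<noteq> Sopt \<Longrightarrow>
    model_le n c \<alpha> x y B t Sopt S \<and> \<not> model_le n c \<alpha> x y B t S Sopt"
  shows "sel B t = Sopt"
proof -
  have "model_le n c \<alpha> x y B t Sopt Sopt" by (simp add: model_le_def)
  then have "{S \<in> models n. \<forall>S'\<in>models n. model_le n c \<alpha> x y B t S S'} = {Sopt}"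
    using assms Sopt by blast
  then show ?thesis using tie[of "{Sopt}"] Sopt by (simp add: S_hat_def)
qed

text \<open>Needed for early times, when nothing is known about the estimates. Before the budget is
  exhausted models are compared by a real number, so a minimiser exists in the finite set and
  \<open>tie\<close> receives a nonempty argument.\<close>

lemma S_hat_in_models:
  assumes "ce * real t < B"
  shows "sel B t \<in> models n"
proof -
  obtain S where S: "is_arg_min (ht B t) (\<lambda>S. S \<in> models n) S"
    using ex_is_arg_min_if_finite[OF finite_models[of n]] Sopt by blast
  then have "S \<in> {S \<in> models n. \<forall>S'\<in>models n. model_le n c \<alpha> x y B t S S'}"
    using assms by (auto simp: model_le_def is_arg_min_linorder)
  then show ?thesis
    using tie[of "{S \<in> models n. \<forall>S'\<in>models n. model_le n c \<alpha> x y B t S S'}"]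
    by (auto simp: S_hat_def)
qed

lemma \<gamma>_eventually_less:
  "\<forall>\<^sub>F t in sequentially. \<forall>S\<in>models n - {Sopt}. \<gamma> t Sopt < \<gamma> t S"
proof (intro eventually_ball_finite ballI)
  show "finite (models n - {Sopt})" using finite_models by simp
  fix S assume S: "S \<in> models n - {Sopt}"
  have "(\<lambda>t. \<gamma> t S - \<gamma> t Sopt) \<longlonglongrightarrow>
      (sqrt (a S) + sqrt (ce * b S))\<^sup>2 - (sqrt (a Sopt) + sqrt (ce * b Sopt))\<^sup>2"
    using S Sopt by (intro tendsto_intros k1_hat_lim k2_hat_lim) auto
  from order_tendstoD(1)[OF this, of 0] Sopt_less[of S] S
  show "\<forall>\<^sub>F t in sequentially. \<gamma> t Sopt < \<gamma> t S" by simp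
qed

text \<open>Here \<open>Sopt\<close> attains its minimum \<open>\<gamma> t Sopt / B\<close>, while
  every other model is at least at its own, larger minimum. The exact end of the budget needs the
  lexicographic comparison instead.\<close>

lemma S_hat_before:
  assumes "n + 2 \<le> t" "0 < B" "ce * real t \<le> B" "real t \<le> B * rate t Sopt"
    and less: "\<And>S. S \<in> models n \<Longrightarrow> S \<noteq> Sopt \<Longrightarrow> \<gamma> t Sopt < \<gamma> t S"
  shows "sel B t = Sopt"
proof (cases "ce * real t < B")
  case True
  have "ht B t Sopt < ht B t S" if "S \<in> models n" "S \<noteq> Sopt" for S
  proof -
    have "ht B t Sopt = \<gamma> t Sopt / B" using assms Sopt by (intro h_hat_before) auto
    also have "\<dots> < \<gamma> t S / B" using less[OF that] assms by (simp add: divide_strict_right_mono)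
    also have "\<dots> \<le> ht B t S" using that assms True by (intro h_hat_ge) auto
    finally show ?thesis .
  qed
  then show ?thesis by (intro S_hat_eqI) (auto simp: model_le_def True intro: less_imp_le simp: not_le)
next
  case False
  with assms have t: "ce * real t = B" by simp
  \<comment> \<open>At the end of the budget the optimal time of \<open>Sopt\<close> can be
    unreached or just reached only if its estimated \<open>k1\<close> vanishes.\<close>
  have "1 / ce \<le> rate t Sopt" using assms ce_pos by (simp add: t[symmetric] field_simps)
  then have k: "k1t t Sopt = 0"
    using opt_rounds_1_less[OF ce_pos, of "k1t t Sopt" "k2t t Sopt"] k1_hat_nonneg[of t Sopt]
      k2_hat_pos[of t Sopt] assms Sopt by fastforce
  have "k1t t Sopt < k1t t S \<or> k1t t Sopt = k1t t S \<and> k2t t Sopt < k2t t S"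
    if "S \<in> models n" "S \<noteq> Sopt" for S
  proof (cases "k1t t S = 0")
    case True
    have "k2t t Sopt > 0" "k2t t S > 0" using that Sopt assms k2_hat_pos by auto
    then have "k2t t Sopt < k2t t S" using less[OF that] k True ce_pos by simp
    then show ?thesis using k True by simp
  next
    case False
    then show ?thesis using k1_hat_nonneg[of t S] that assms k by simp
  qed
  then show ?thesis by (intro S_hat_eqI) (fastforce simp: model_le_def t)
qed

text \<open>
  If \<open>k\<^sub>1(S\<^sup>*) > 0\<close>, then \<open>B h\<^sub>S\<^sub>*\<close> is continuous around its minimiser \<open>u = t / B = r\<close>, so the strict gap
  between the minima persists there. If \<open>k\<^sub>1(S\<^sup>*) = 0\<close>, then \<open>r = 1 / c\<^sub>e\<^sub>p\<^sub>r\<close> is the end of the budget,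
  where the term \<open>k\<^sub>1(S) / (B - c\<^sub>e\<^sub>p\<^sub>r t)\<close> of any other model explodes.
\<close>

lemma S_hat_eventually_eq:
  "\<exists>T \<epsilon>. n + 2 \<le> T \<and> 0 < \<epsilon> \<and> (\<forall>B t. 0 < B \<longrightarrow> T \<le> t \<longrightarrow> ce * real t \<le> B \<longrightarrow> real t \<le> B * (r + \<epsilon>) \<longrightarrow>
     sel B t = Sopt)"
proof -
  \<comment> \<open>Time \<open>t\<close> and budget share \<open>u = t / B\<close> are treated as
    independent variables near infinity and \<open>r\<close>. This makes the resulting bounds
    uniform in \<open>B\<close>.\<close>
  define F where "F = sequentially \<times>\<^sub>F nhds r"
  have fst_lim: "((\<lambda>p. f (fst p)) \<longlongrightarrow> l) F" if "f \<longlonglongrightarrow> l" for f :: "nat \<Rightarrow> real" and l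
    unfolding F_def by (rule filterlim_compose[OF that filterlim_fst])
  have snd_lim: "(snd \<longlongrightarrow> r) F" unfolding F_def by (rule filterlim_snd)
  note k1F = fst_lim[OF k1_hat_lim] and k2F = fst_lim[OF k2_hat_lim] and rateF = fst_lim[OF rate_lim]
  \<comment> \<open>What is needed once \<open>t\<close> has passed the optimal time of
    \<open>Sopt\<close>. In the first case \<open>B * h\<close> of \<open>Sopt\<close> at share
    \<open>u\<close> lies below the minimum for \<open>S\<close>. In the second case
    \<open>S\<close> has passed its optimal time too, and the difference of the objectives is
    compared after clearing denominators, which keeps it continuous at
    \<open>u = 1 / ce\<close>.\<close>
  define E where "E S p \<longleftrightarrow> (let t = fst p; u = snd p in
     0 < u \<and> (if 0 < a Sopt then ce * u < 1 \<and> k1t t Sopt / (1 - ce * u) + k2t t Sopt / u < \<gamma> t S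
      else rate t S < u \<and> k1t t Sopt < k1t t S \<and>
        0 < (k1t t S - k1t t Sopt) * u + (k2t t S - k2t t Sopt) * (1 - ce * u)))"
    for S and p :: "nat \<times> real"
  have "\<forall>\<^sub>F p in F. E S p" if S: "S \<in> models n - {Sopt}" for S
  proof -
    have pos: "\<forall>\<^sub>F p in F. 0 < snd p" using order_tendstoD(1)[OF snd_lim r_pos] .
    show ?thesis
    proof (cases "0 < a Sopt")
      case True
      have r1: "ce * r < 1"
        using opt_rounds_1_less[OF ce_pos True b_pos[OF Sopt]] ce_pos by (simp add: field_simps)
      have "\<forall>\<^sub>F p in F. ce * snd p < 1"
        by (rule order_tendstoD(2)[OF tendsto_mult_left[OF snd_lim] r1])
      \<comment> \<open>At the limit point the subtracted term is the minimum for
        \<open>Sopt\<close> with \<open>B = 1\<close>, so \<open>Sopt_less\<close> makes the limit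
        positive.\<close>
      moreover have "((\<lambda>p. \<gamma> (fst p) S - (k1t (fst p) Sopt / (1 - ce * snd p) + k2t (fst p) Sopt / snd p)) \<longlongrightarrow>
        (sqrt (a S) + sqrt (ce * b S))\<^sup>2 - (a Sopt / (1 - ce * r) + b Sopt / r)) F"
        using S Sopt r1 r_pos by (intro tendsto_intros k1F k2F snd_lim) auto
      then have "\<forall>\<^sub>F p in F. 0 < \<gamma> (fst p) S - (k1t (fst p) Sopt / (1 - ce * snd p) + k2t (fst p) Sopt / snd p)"
        by (rule order_tendstoD)
          (use Sopt_less[of S] S exploration_objective_at_optimum[OF a_nonneg[OF Sopt] b_pos[OF Sopt] ce_pos, of 1 r]
           in simp)
      ultimately show ?thesis using pos by eventually_elim (simp add: E_def Let_def True)
    next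
      case False
      then have a0: "a Sopt = 0" using a_nonneg[OF Sopt] by simp
      then have r: "r = 1 / ce" by (simp add: opt_rounds_def)
      have aS: "0 < a S" using degenerate[OF _ _ a0] S by simp
      have "((\<lambda>p. snd p - rate (fst p) S) \<longlongrightarrow> r - opt_rounds ce 1 (a S) (b S)) F"
        using S by (intro tendsto_intros rateF snd_lim) auto
      then have "\<forall>\<^sub>F p in F. 0 < snd p - rate (fst p) S"
        by (rule order_tendstoD) (use opt_rounds_1_less[OF ce_pos aS b_pos] S r in simp)
      moreover have "((\<lambda>p. k1t (fst p) S - k1t (fst p) Sopt) \<longlongrightarrow> a S - a Sopt) F"
        using S Sopt by (intro tendsto_intros k1F) auto
      then have "\<forall>\<^sub>F p in F. 0 < k1t (fst p) S - k1t (fst p) Sopt"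
        by (rule order_tendstoD) (use aS a0 in simp)
      \<comment> \<open>Since \<open>ce * r = 1\<close> and \<open>a Sopt = 0\<close>, the limit is
        \<open>a S * r\<close>, which is positive.\<close>
      moreover have "((\<lambda>p. (k1t (fst p) S - k1t (fst p) Sopt) * snd p + (k2t (fst p) S - k2t (fst p) Sopt) * (1 - ce * snd p))
          \<longlongrightarrow> (a S - a Sopt) * r + (b S - b Sopt) * (1 - ce * r)) F"
        using S Sopt by (intro tendsto_intros k1F k2F snd_lim) auto
      then have "\<forall>\<^sub>F p in F. 0 < (k1t (fst p) S - k1t (fst p) Sopt) * snd p + (k2t (fst p) S - k2t (fst p) Sopt) * (1 - ce * snd p)"
        by (rule order_tendstoD) (use aS a0 ce_pos r in simp)
      ultimately show ?thesis using pos by eventually_elim (simp add: E_def Let_def False)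
    qed
  qed
  then have "\<forall>\<^sub>F p in F. \<forall>S\<in>models n - {Sopt}. E S p"
    by (intro eventually_ball_finite) (auto simp: finite_models)
  then obtain P Q where P: "\<forall>\<^sub>F t in sequentially. P t" and Q: "\<forall>\<^sub>F u in nhds r. Q u"
    and PQ: "\<forall>t. P t \<longrightarrow> (\<forall>u. Q u \<longrightarrow> (\<forall>S\<in>models n - {Sopt}. E S (t, u)))"
    unfolding F_def eventually_prod_filter by (elim exE conjE) (rule that, auto)
  obtain d where d: "d > 0" and dQ: "\<And>u. dist u r < d \<Longrightarrow> Q u"
    using Q unfolding eventually_nhds_metric by auto
  \<comment> \<open>Guarantees \<open>u > r - d\<close> for every \<open>t\<close> beyond
    \<open>B * rate t Sopt\<close>. Together with the choice \<open>\<epsilon> = d / 2\<close>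
    below, \<open>u\<close> stays in the neighbourhood where \<open>E\<close> holds.\<close>
  have "\<forall>\<^sub>F t in sequentially. r - d < rate t Sopt"
    by (rule order_tendstoD(1)[OF rate_lim[OF Sopt]]) (use d in simp)
  with P \<gamma>_eventually_less have "\<forall>\<^sub>F t in sequentially. P t \<and> r - d < rate t Sopt \<and> (\<forall>S\<in>models n - {Sopt}. \<gamma> t Sopt < \<gamma> t S)"
    by eventually_elim simp
  then obtain T where T: "\<And>t. T \<le> t \<Longrightarrow> P t \<and> r - d < rate t Sopt \<and> (\<forall>S\<in>models n - {Sopt}. \<gamma> t Sopt < \<gamma> t S)"
    unfolding eventually_sequentially by blast
  show ?thesis
  proof (intro exI[of _ "max T (n + 2)"] exI[of _ "d / 2"] conjI allI impI)
    fix B :: real and t :: nat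
    assume B: "0 < B" and "max T (n + 2) \<le> t" and ceB: "ce * real t \<le> B" and upper: "real t \<le> B * (r + d / 2)"
    then have tT: "T \<le> t" and tn: "n + 2 \<le> t" by auto
    note T = T[OF tT]
    show "sel B t = Sopt"
    proof (cases "real t \<le> B * rate t Sopt")
      case True
      then show ?thesis using S_hat_before[OF tn B ceB] T by simp
    next
      case late: False
      define u where "u = real t / B"
      have tu: "real t = B * u" using B by (simp add: u_def)
      have "r - d < u" "u \<le> r + d / 2"
        using late T upper B by (auto simp: tu)
      then have "Q u" using d by (intro dQ) (simp add: dist_real_def abs_less_iff)
      then have E: "E S (t, u)" if "S \<in> models n" "S \<noteq> Sopt" for S using PQ T that by simp
      have hopt: "ht B t Sopt = k1t t Sopt / (B - ce * real t) + k2t t Sopt / real t"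
        using late by (intro h_hat_after) simp
      show ?thesis
      proof (cases "0 < a Sopt")
        case True
        have "model_le n c \<alpha> x y B t Sopt S \<and> \<not> model_le n c \<alpha> x y B t S Sopt"
          if S: "S \<in> models n" "S \<noteq> Sopt" for S
        proof -
          have e: "0 < u" "ce * u < 1" "k1t t Sopt / (1 - ce * u) + k2t t Sopt / u < \<gamma> t S"
            using E[OF S] True by (auto simp: E_def)
          have lt: "ce * real t < B" using e B by (simp add: tu)
          have "B - ce * real t = B * (1 - ce * u)" by (simp add: tu algebra_simps)
          then have "ht B t Sopt = (k1t t Sopt / (1 - ce * u) + k2t t Sopt / u) / B"
            unfolding hopt by (simp add: tu add_divide_distrib mult.commute)
          also have "\<dots> < \<gamma> t S / B" using e B by (simp add: divide_strict_right_mono)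
          also have "\<dots> \<le> ht B t S" by (rule h_hat_ge[OF tn S(1) lt])
          finally show ?thesis by (simp add: model_le_def lt)
        qed
        then show ?thesis by (rule S_hat_eqI)
      next
        case False
        have "model_le n c \<alpha> x y B t Sopt S \<and> \<not> model_le n c \<alpha> x y B t S Sopt"
          if S: "S \<in> models n" "S \<noteq> Sopt" for S
        proof (cases "ce * real t < B")
          case lt: True
          have e: "0 < u" "rate t S < u"
            "0 < (k1t t S - k1t t Sopt) * u + (k2t t S - k2t t Sopt) * (1 - ce * u)"
            using E[OF S] False by (auto simp: E_def)
          have "1 - ce * u > 0" using lt B by (simp add: tu)
          then have "0 < ((k1t t S - k1t t Sopt) * u + (k2t t S - k2t t Sopt) * (1 - ce * u)) / (u * (1 - ce * u) * B)"
            using e B by simp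
          also have "\<dots> = (k1t t S / (1 - ce * u) + k2t t S / u) / B - (k1t t Sopt / (1 - ce * u) + k2t t Sopt / u) / B"
          proof -
            have "((p - q) * u + (p' - q') * v) / (u * v * B) = (p / v + p' / u) / B - (q / v + q' / u) / B"
              if "0 < v" for p q p' q' v :: real
              using e B that by (simp add: field_simps)
            then show ?thesis using \<open>1 - ce * u > 0\<close> by blast
          qed
          also have "(k1t t S / (1 - ce * u) + k2t t S / u) / B = k1t t S / (B - ce * real t) + k2t t S / real t"
            using B by (simp add: tu add_divide_distrib algebra_simps)
          also have "\<dots> = ht B t S" using e B by (intro h_hat_after[symmetric]) (simp add: tu)
          also have "(k1t t Sopt / (1 - ce * u) + k2t t Sopt / u) / B = ht B t Sopt"
            unfolding hopt using B by (simp add: tu add_divide_distrib algebra_simps)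
          finally show ?thesis by (simp add: model_le_def lt)
        next
          \<comment> \<open>Here the budget is exactly exhausted and \<open>model_le\<close> is
            lexicographic; \<open>E\<close> provides the strict inequality between the values of
            \<open>k1t\<close>.\<close>
          case False
          then show ?thesis using E[OF S] \<open>\<not> 0 < a Sopt\<close> by (auto simp: E_def model_le_def)
        qed
        then show ?thesis by (rule S_hat_eqI)
      qed
    qed
  qed (use d in auto)
qed

text \<open>At late times \<open>Sopt\<close> is selected, so no stop occurs before
  \<open>B * (r - \<delta>)\<close>, and the first integer slightly beyond \<open>B * r\<close> is a
  stopping time if the budget allows it. The factor 2 absorbs rounding up to an integer.\<close>

lemma aetc_rounds_bounds:
  assumes "0 < \<delta>"
  shows "\<forall>\<^sub>F B in at_top. B * (r - \<delta>) \<le> rounds B \<and> real (rounds B) \<le> B * (r + 2 * \<delta>) \<and>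
    aetc_model n c \<alpha> tie x y B = Sopt"
proof -
  obtain T \<epsilon> where T: "n + 2 \<le> T" and \<epsilon>: "0 < \<epsilon>"
    and sel: "\<And>B t. 0 < B \<Longrightarrow> T \<le> t \<Longrightarrow> ce * real t \<le> B \<Longrightarrow> real t \<le> B * (r + \<epsilon>) \<Longrightarrow> sel B t = Sopt"
    using S_hat_eventually_eq by blast
  \<comment> \<open>\<open>2 * \<eta> \<le> \<epsilon>\<close> keeps the candidate \<open>t1\<close>
    in the range where \<open>Sopt\<close> is selected, and \<open>\<eta> < r\<close> makes
    \<open>B * (r - \<eta>)\<close> grow beyond \<open>T1\<close>.\<close>
  define \<eta> where "\<eta> = min \<delta> (min (\<epsilon> / 2) (r / 2))"
  have \<eta>: "0 < \<eta>" "\<eta> \<le> \<delta>" "2 * \<eta> \<le> \<epsilon>" "\<eta> < r" using assms \<epsilon> r_pos by (auto simp: \<eta>_def)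
  have "\<forall>\<^sub>F t in sequentially. dist (rate t Sopt) r < \<eta>"
    by (rule tendstoD[OF rate_lim[OF Sopt] \<eta>(1)])
  then obtain T0 where T0: "\<And>t. T0 \<le> t \<Longrightarrow> dist (rate t Sopt) r < \<eta>"
    unfolding eventually_sequentially by blast
  define T1 where "T1 = max T T0"
  have large: "\<forall>\<^sub>F B in at_top. k \<le> B * l" if "0 < l" for k l :: real
    using eventually_ge_at_top[of "k / l"] by eventually_elim (use that in \<open>simp add: field_simps\<close>)
  have largeS: "\<forall>\<^sub>F B in at_top. k < B * l" if "0 < l" for k l :: real
    using eventually_gt_at_top[of "k / l"] by eventually_elim (use that in \<open>simp add: field_simps\<close>)
  \<comment> \<open>For the finitely many early times every rate is positive, so for large
    \<open>B\<close> no model would stop there, whichever is selected.\<close>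
  have "\<forall>\<^sub>F B in at_top. \<forall>t\<in>{n + 2..<T1}. \<forall>S\<in>models n. real t < B * rate t S"
    by (intro eventually_ball_finite ballI largeS rate_pos finite_models) auto
  moreover have "\<forall>\<^sub>F B in at_top. \<forall>t\<in>{n + 2..<T1}. ce * real t < B * 1"
    by (intro eventually_ball_finite ballI largeS) auto
  moreover have "\<forall>\<^sub>F B in at_top. 1 \<le> B * \<eta>" by (rule large[OF \<eta>(1)])
  moreover have "\<forall>\<^sub>F B in at_top. real T1 \<le> B * (r - \<eta>)" using \<eta> by (intro large) simp
  moreover have "\<forall>\<^sub>F B in at_top. real T1 + 1 \<le> B * (1 / ce)" using ce_pos by (intro large) simp
  moreover have "\<forall>\<^sub>F B :: real in at_top. 0 < B" by (rule eventually_gt_at_top)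
  ultimately show ?thesis
  proof eventually_elim
    case (elim B)
    note early = elim(1) and earlyB = elim(2) and B\<eta> = elim(3) and T1B = elim(4) and T1M = elim(5) and B = elim(6)
    let ?M = "max_rounds n c B"
    let ?stops = "stops n c \<alpha> tie x y B"
    have Mle: "ce * real t \<le> B" if "t \<le> ?M" for t
    proof -
      have "real t \<le> real ?M" using that by simp
      also have "\<dots> \<le> B / ce" using B ce_pos by (simp add: max_rounds_def)
      finally show ?thesis using ce_pos by (simp add: field_simps)
    qed
    have M_ge: "B / ce - 1 \<le> real ?M" unfolding max_rounds_def by linarith
    have stop_lower: "B * (r - \<eta>) \<le> real t" and stop_T1: "T1 \<le> t" and stop_M: "t \<le> ?M" if "?stops t" for t
    proof -
      have t: "n + 2 \<le> t" "t \<le> ?M" and st: "B * rate t (sel B t) \<le> real t"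
        using that by (auto simp: stops_def m_hat_eq)
      show "t \<le> ?M" by fact
      show T1: "T1 \<le> t"
      proof (rule ccontr)
        assume "\<not> T1 \<le> t"
        then have t': "t \<in> {n + 2..<T1}" using t by simp
        then have "sel B t \<in> models n" using earlyB by (intro S_hat_in_models) simp
        then show False using early t' st by force
      qed
      show "B * (r - \<eta>) \<le> real t"
      \<comment> \<open>Beyond this range the selected model is not controlled, but the lower bound
        is then trivial.\<close>
      proof (cases "real t \<le> B * (r + \<epsilon>)")
        case True
        then have "sel B t = Sopt" using T1 B t Mle by (intro sel) (auto simp: T1_def)
        moreover have "r - \<eta> \<le> rate t Sopt" using T0[of t] T1 by (auto simp: T1_def dist_real_def)
        ultimately show ?thesis using st B by (smt (verit) mult_left_mono)
      next
        case False
        moreover have "B * (r - \<eta>) \<le> B * (r + \<epsilon>)" using B \<eta> \<epsilon> by (intro mult_left_mono) auto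
        ultimately show ?thesis by linarith
      qed
    qed
    have no_stop: "rounds B = ?M" if "\<nexists>t. ?stops t" using that by (auto simp: aetc_rounds_def)
    have stop: "?stops (rounds B)" "\<And>t. ?stops t \<Longrightarrow> rounds B \<le> t" if "\<exists>t. ?stops t"
      using that LeastI_ex[OF that] by (auto simp: aetc_rounds_def intro: Least_le)
    have lower: "B * (r - \<eta>) \<le> real (rounds B)"
    proof (cases "\<exists>t. ?stops t")
      case False
      \<comment> \<open>Without a stop the number of rounds is the integer part of
        \<open>B / ce\<close>. The rounding loss of at most 1 is covered by
        \<open>1 \<le> B * \<eta>\<close>.\<close>
      have "B * r \<le> B * (1 / ce)" using r_le B by (intro mult_left_mono) auto
      then show ?thesis using no_stop[OF False] M_ge B\<eta> by (simp add: algebra_simps)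
    qed (use stop stop_lower in blast)
    have leM: "rounds B \<le> ?M" and geT: "T1 \<le> rounds B"
    proof -
      show "rounds B \<le> ?M" by (cases "\<exists>t. ?stops t") (use stop stop_M no_stop in auto)
      have "T1 \<le> ?M" using M_ge T1M by simp
      then show "T1 \<le> rounds B" by (cases "\<exists>t. ?stops t") (use stop stop_T1 no_stop in auto)
    qed
    \<comment> \<open>The rates are below \<open>r + \<eta>\<close> at late times, so
      \<open>t1\<close> is a stopping time unless it exceeds the maximal number of rounds, which
      bounds \<open>rounds B\<close> in any case.\<close>
    define t1 where "t1 = nat \<lceil>B * (r + \<eta>)\<rceil>"
    have Br: "B * (r + \<eta>) > 0" using B r_pos \<eta> by simp
    have t1: "B * (r + \<eta>) \<le> real t1" "real t1 \<le> B * (r + \<eta>) + 1"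
      using Br unfolding t1_def by linarith+
    have t1': "real t1 \<le> B * (r + 2 * \<eta>)" using t1 B\<eta> by (simp add: algebra_simps)
    have "rounds B \<le> t1"
    proof (cases "t1 \<le> ?M")
      case True
      have "B * (r - \<eta>) \<le> B * (r + \<eta>)" using B \<eta> by simp
      then have T1t: "T1 \<le> t1" using t1 T1B by linarith
      have "B * (r + 2 * \<eta>) \<le> B * (r + \<epsilon>)" using B \<eta> by (intro mult_left_mono) auto
      then have "real t1 \<le> B * (r + \<epsilon>)" using t1' by linarith
      then have "sel B t1 = Sopt" using T1t True B Mle by (intro sel) (auto simp: T1_def)
      moreover have "rate t1 Sopt \<le> r + \<eta>" using T0[of t1] T1t by (auto simp: T1_def dist_real_def)
      then have "B * rate t1 Sopt \<le> real t1" using t1 B by (smt (verit) mult_left_mono)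
      ultimately have "?stops t1" using True T1t T by (simp add: stops_def m_hat_eq T1_def)
      then show ?thesis using stop by blast
    qed (use leM in simp)
    then have upper: "real (rounds B) \<le> B * (r + 2 * \<eta>)" using t1' by linarith
    have "B * (r + 2 * \<eta>) \<le> B * (r + \<epsilon>)" using B \<eta> by (intro mult_left_mono) auto
    then have "real (rounds B) \<le> B * (r + \<epsilon>)" using upper by linarith
    then have "sel B (rounds B) = Sopt"
      using geT leM B Mle by (intro sel) (auto simp: T1_def)
    moreover have "B * (r - \<delta>) \<le> B * (r - \<eta>)" "B * (r + 2 * \<eta>) \<le> B * (r + 2 * \<delta>)"
      using B \<eta> by (auto intro!: mult_left_mono)
    ultimately show ?case using lower upper by (auto simp: aetc_model_def)
  qed
qed

lemma aetc_consistent: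
  "((\<lambda>B. real (rounds B) / opt_rounds ce B (a Sopt) (b Sopt)) \<longlongrightarrow> 1) at_top"
  "\<forall>\<^sub>F B in at_top. aetc_model n c \<alpha> tie x y B = Sopt"
proof -
  have "((\<lambda>B. real (rounds B) / B) \<longlongrightarrow> r) at_top"
  proof (rule tendstoI)
    fix e :: real assume e: "0 < e"
    have "\<forall>\<^sub>F B :: real in at_top. 0 < B" by (rule eventually_gt_at_top)
    moreover have "\<forall>\<^sub>F B in at_top. B * (r - e / 3) \<le> rounds B \<and> real (rounds B) \<le> B * (r + 2 * (e / 3)) \<and>
      aetc_model n c \<alpha> tie x y B = Sopt"
      using e by (intro aetc_rounds_bounds) simp
    ultimately show "\<forall>\<^sub>F B in at_top. dist (real (rounds B) / B) r < e"
    proof eventually_elim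
      case (elim B)
      then have "r - e / 3 \<le> rounds B / B" "rounds B / B \<le> r + 2 * (e / 3)"
        by (auto simp: pos_le_divide_eq pos_divide_le_eq mult.commute)
      then show ?case using e by (auto simp: dist_real_def abs_if)
    qed
  qed
  from tendsto_divide[OF this tendsto_const[of r]]
  have "((\<lambda>B. real (rounds B) / B / r) \<longlongrightarrow> 1) at_top" using r_pos by simp
  then show "((\<lambda>B. real (rounds B) / opt_rounds ce B (a Sopt) (b Sopt)) \<longlongrightarrow> 1) at_top"
    by (subst opt_rounds_scale) (simp add: field_simps)
  show "\<forall>\<^sub>F B in at_top. aetc_model n c \<alpha> tie x y B = Sopt"
    using aetc_rounds_bounds[of 1] by (auto elim: eventually_mono)
qed

end

section \<open>Almost sure consistency\<close>

text \<open>One null set serves all real budgets, because a single infinite sample path underlies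
  them.\<close>

theorem theorem5p3:
  fixes n :: nat
    and P :: "'p measure" and X :: "nat \<Rightarrow> 'p \<Rightarrow> real" and Y :: "'p \<Rightarrow> real"
    and M :: "'w measure" and Xs :: "nat \<Rightarrow> nat \<Rightarrow> 'w \<Rightarrow> real" and Ys :: "nat \<Rightarrow> 'w \<Rightarrow> real"
    and c \<alpha> :: "nat \<Rightarrow> real" and \<beta> :: "nat set \<Rightarrow> real vec" and \<sigma>2 :: "nat set \<Rightarrow> real"
    and K :: real and tie :: "nat set set \<Rightarrow> nat set" and Sopt :: "nat set"
  assumes "prob_space P" and "prob_space M"
    and "\<forall>i\<in>{1..n}. X i \<in> borel_measurable P" and "Y \<in> borel_measurable P"
    and "iid_samples n P X Y M Xs Ys"
    and "\<forall>i\<in>{0..n}. c i > 0"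
    and "AE \<omega> in M. \<forall>t\<ge>n + 2. \<forall>S\<in>models n.
           vec_space.rank t (design (\<lambda>l i. Xs l i \<omega>) t S) = card S + 1"
    and "\<forall>S\<in>models n. linear_model P X Y S (\<beta> S) (\<sigma>2 S)"
    and "\<forall>S\<in>models n. invertible_mat (moment_mat P X S)"
    and "\<forall>S\<in>models n. \<sigma>2 S > 0"
    and "1 \<le> K" and "\<forall>S\<in>models n. moment_bound P X S K"
    and "\<forall>t. \<alpha> t > 0" and "decseq \<alpha>" and "\<alpha> \<longlonglongrightarrow> 0"
    and "\<forall>A. A \<noteq> {} \<and> A \<subseteq> models n \<longrightarrow> tie A \<in> A"
    and "{S. is_arg_min (\<lambda>S. (sqrt (k1 P X c \<beta> S) + sqrt (c_epr n c * k2 P X \<sigma>2 S))\<^sup>2)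
               (\<lambda>S. S \<in> models n) S} = {Sopt}"
  shows "AE \<omega> in M.
           ((\<lambda>B. real (aetc_rounds n c \<alpha> tie (\<lambda>l i. Xs l i \<omega>) (\<lambda>l. Ys l \<omega>) B)
                  / opt_rounds (c_epr n c) B (k1 P X c \<beta> Sopt) (k2 P X \<sigma>2 Sopt)) \<longlongrightarrow> 1) at_top \<and>
           (\<forall>\<^sub>F B in at_top. aetc_model n c \<alpha> tie (\<lambda>l i. Xs l i \<omega>) (\<lambda>l. Ys l \<omega>) B = Sopt)"
proof -
  note P = assms(1) and M = assms(2) and X = assms(3) and Y = assms(4) and iid = assms(5) and c = assms(6)
    and rank = assms(7) and lm = assms(8) and inv = assms(9) and \<sigma>2 = assms(10) and mb = assms(12)
    and \<alpha> = assms(13) and \<alpha>_lim = assms(15) and tie = assms(16) and opt = assms(17)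
  let ?a = "k1 P X c \<beta>" and ?b = "k2 P X \<sigma>2"
  let ?\<gamma> = "\<lambda>S. (sqrt (?a S) + sqrt (c_epr n c * ?b S))\<^sup>2"
  have ce: "0 < c_epr n c" unfolding c_epr_def using c by (intro sum_pos) auto
  have ept: "0 < c_ept c S" if "S \<in> models n" for S
    unfolding c_ept_def using that c models_finite[OF that] by (intro sum_pos) (auto simp: models_def)
  have b_eq: "?b S = \<sigma>2 S" if "S \<in> models n" for S using k2_eq[OF P X that] mb inv that by blast
  have min: "?\<gamma> Sopt \<le> ?\<gamma> S" if "S \<in> models n" for S
    using opt that by (auto simp: set_eq_iff is_arg_min_linorder)
  have Sopt: "Sopt \<in> models n" using opt by (auto simp: set_eq_iff is_arg_min_linorder)
  have less: "?\<gamma> Sopt < ?\<gamma> S" if S: "S \<in> models n" "S \<noteq> Sopt" for S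
  proof (rule ccontr)
    assume "\<not> ?\<gamma> Sopt < ?\<gamma> S"
    then have "is_arg_min ?\<gamma> (\<lambda>S. S \<in> models n) S"
      using min S by (fastforce simp: is_arg_min_linorder)
    then show False using opt S by blast
  qed
  have "AE \<omega> in M. \<forall>S\<in>models n.
    (\<forall>i\<in>{..<card S + 1}. \<forall>j\<in>{..<card S + 1}. avg (\<lambda>l. feat S (\<lambda>i. Xs l i \<omega>) $ i * feat S (\<lambda>i. Xs l i \<omega>) $ j)
       \<longlonglongrightarrow> moment_mat P X S $$ (i, j)) \<and>
    (\<forall>i\<in>{..<card S + 1}. avg (\<lambda>l. feat S (\<lambda>i. Xs l i \<omega>) $ i * Ys l \<omega>) \<longlonglongrightarrow> (moment_mat P X S *\<^sub>v \<beta> S) $ i) \<and>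
    avg (\<lambda>l. Ys l \<omega> * Ys l \<omega>) \<longlonglongrightarrow> \<sigma>2 S + \<beta> S \<bullet> (moment_mat P X S *\<^sub>v \<beta> S)"
    using lm mb by (intro AE_finite_allI finite_models sample_moments_converge[OF P M X Y iid]) auto
  with rank show ?thesis
  proof eventually_elim
    case (elim \<omega>)
    let ?x = "\<lambda>l i. Xs l i \<omega>" and ?y = "\<lambda>l. Ys l \<omega>"
    have det: "det (gram ?x t S) \<noteq> 0" if "n + 2 \<le> t" "S \<in> models n" for t S
      using elim(1) that by (intro det_gram_nonzero[OF design_carrier]) auto
    \<comment> \<open>Hence \<open>n + 2\<close> initial samples leave every model at least one
      residual degree of freedom.\<close>
    have card: "card S \<le> n" if "S \<in> models n" for S
      using card_mono[of "{1..n}" S] that by (simp add: models_def)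
    have k1_nonneg: "0 \<le> k1_hat c ?x ?y t S" if "n + 2 \<le> t" "S \<in> models n" for t S
      using that ept by (intro k1_hat_ge_0 det) (auto intro: less_imp_le)
    have k2_pos: "0 < k2_hat \<alpha> ?x ?y t S" if "n + 2 \<le> t" "S \<in> models n" for t S
      using that card[of S] \<alpha> by (intro k2_hat_gt_0 det) auto
    have k1_lim: "(\<lambda>t. k1_hat c ?x ?y t S) \<longlonglongrightarrow> ?a S"
      and k2_lim: "(\<lambda>t. k2_hat \<alpha> ?x ?y t S) \<longlonglongrightarrow> ?b S" if S: "S \<in> models n" for S
    proof -
      let ?L = "moment_mat P X S"
      have L: "?L \<in> carrier_mat (card S + 1) (card S + 1)" by (simp add: moment_mat_def)
      have \<beta>: "\<beta> S \<in> carrier_vec (card S + 1)" using lm S by (simp add: linear_model_def)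
      have "det ?L \<noteq> 0" using invertible_mat_det_nonzero[OF L] inv S by blast
      note conv = estimators_converge[OF det[OF _ S] L this \<beta>, where y = ?y and q = "\<sigma>2 S + \<beta> S \<bullet> (?L *\<^sub>v \<beta> S)"]
      have "(\<lambda>t. beta_hat ?x ?y t S \<bullet> (cov_hat ?x t S *\<^sub>v beta_hat ?x ?y t S)) \<longlonglongrightarrow> \<beta> S \<bullet> (cov_mat P X S *\<^sub>v \<beta> S)"
        unfolding quad_cov_mat[OF P X S mb[rule_format, OF S] \<beta>]
        using elim(2) S by (intro conv(1)) auto
      then show "(\<lambda>t. k1_hat c ?x ?y t S) \<longlonglongrightarrow> ?a S"
        unfolding k1_hat_def k1_def by (rule tendsto_mult_left)
      have "(\<lambda>t. var_hat ?x ?y t S) \<longlonglongrightarrow> \<sigma>2 S + \<beta> S \<bullet> (?L *\<^sub>v \<beta> S) - \<beta> S \<bullet> (?L *\<^sub>v \<beta> S)"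
        using elim(2) S by (intro conv(2)) auto
      from tendsto_add[OF this \<alpha>_lim] have "(\<lambda>t. var_hat ?x ?y t S + \<alpha> t) \<longlonglongrightarrow> ?b S" using b_eq[OF S] by simp
      moreover have "\<forall>\<^sub>F t in sequentially. var_hat ?x ?y t S + \<alpha> t = k2_hat \<alpha> ?x ?y t S"
        using eventually_ge_at_top[of "n + 2"]
        by eventually_elim (simp add: k2_hat_def trace_term_hat det[OF _ S])
      ultimately show "(\<lambda>t. k2_hat \<alpha> ?x ?y t S) \<longlonglongrightarrow> ?b S" by (rule Lim_transform_eventually)
    qed
    have a_nonneg: "0 \<le> ?a S" if "S \<in> models n" for S
      by (rule LIMSEQ_le_const[OF k1_lim[OF that]]) (use that k1_nonneg in blast)
    interpret consistent_path n c \<alpha> tie ?x ?y ?a ?b Sopt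
    proof
      \<comment> \<open>If \<open>?a S\<close> vanished as well, both models would have the full
        variance of \<open>Y\<close> as noise variance. Their objectives would then agree, against
        the strict inequality \<open>less\<close>.\<close>
      fix S assume S: "S \<in> models n" "S \<noteq> Sopt" and a0: "?a Sopt = 0"
      show "0 < ?a S"
      proof (rule ccontr)
        assume "\<not> 0 < ?a S"
        then have "?a S = 0" using a_nonneg[OF S(1)] by simp
        have var: "\<sigma>2 T = (\<integral>\<omega>. Y \<omega> * Y \<omega> \<partial>P) - (\<integral>\<omega>. Y \<omega> \<partial>P)\<^sup>2" if "T \<in> models n" "?a T = 0" for T
          using explained_variance[OF P X Y that(1) lm[rule_format, OF that(1)] mb[rule_format, OF that(1)]]
            that ept[OF that(1)] by (simp add: k1_def)
        have "\<sigma>2 S = \<sigma>2 Sopt" using var[OF S(1) \<open>?a S = 0\<close>] var[OF Sopt a0] by simp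
        then show False using less[OF S] a0 \<open>?a S = 0\<close> b_eq S Sopt by simp
      qed
    qed (use ce tie k1_nonneg k2_pos k1_lim k2_lim b_eq \<sigma>2 Sopt less in auto)
    show ?case using aetc_consistent by blast
  qed
qed

end
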